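(* Let $K$ be a field and let $E$ be a row-finite directed graph. Then the following are equivalent: (1) $L_K(E)$ satisfies the ascending chain condition on two-sided ideals. (2) $L_K(E)$ satisfies the ascending chain condition on two-sided graded ideals. (3) The hereditary saturated closures $\overline{X}$ of the subsets $X\subseteq E^0$ satisfy the ascending chain condition (with respect to inclusion).
   Context: A directed graph $E=(E^0,E^1,r,s)$ consists of a set $E^0$ of vertices, a set $E^1$ of edges, and functions $r,s:E^1\to E^0$ (range and source). $E$ is row-finite if every vertex is the source of at most finitely many edges. Leavitt path algebra: $L_K(E)$ is the (associative, not necessarily unital) $K$-algebra generated by the set $E^0$ together with $\{e,e^*\mid e\in E^1\}$, subject to the relations: (1) $vv'=\delta_{v,v'}v$ for all $v,v'\in E^0$; (2) $s(e)e=e\,r(e)=e$ for all $e\in E^1$; (3) $r(e)e^*=e^*s(e)=e^*$ for all $e\in E^1$; (4) $e^*f=\delta_{e,f}r(e)$ for all $e,f\in E^1$; (5) $v=\sum_{\{e\in E^1\mid s(e)=v\}}ee^*$ for every $v\in E^0$ with $0<|s^{-1}(v)|<\infty$. Graded ideals are taken with respect to the standard $\mathbb{Z}$-grading of $L_K(E)$, in which vertices have degree $0$, each $e\in E^1$ has degree $1$ and each $e^*$ has degree $-1$. Hereditary saturated closure: a path is a sequence of edges $\mu=e_1\cdots e_n$ with $r(e_i)=s(e_{i+1})$ for $i=1,\dots,n-1$; $s(\mu)=s(e_1)$, $r(\mu)=r(e_n)$. For $v,w\in E^0$ write $v\ge w$ if $v=w$ or there is a path $\mu$ with $s(\mu)=v$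 and $r(\mu)=w$. A subset $H\subseteq E^0$ is hereditary if $w\in H$ and $w\ge v$ imply $v\in H$; it is saturated if whenever $0<|s^{-1}(v)|<\infty$ and $\{r(e): s(e)=v\}\subseteq H$, then $v\in H$. The hereditary saturated closure $\overline{X}$ of $X\subseteq E^0$ is the smallest hereditary and saturated subset of $E^0$ containing $X$. *)

theory Defs
  imports
    "Graph_Theory.Arc_Walk"
    "HOL-Algebra.QuotRing"
    "HOL-Algebra.Module"
    "HOL-Library.Poly_Mapping"
begin

section \<open>Directed graphs\<close>

text \<open>
  A directed graph \<open>(E\<^sup>0, E\<^sup>1, r, s)\<close> is a well-formed digraph \<open>G\<close> with
  \<open>verts G = E\<^sup>0\<close>, \<open>arcs G = E\<^sup>1\<close>, \<open>head G = r\<close> and \<open>tail G = s\<close>; both sets may be infinite,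
  and loops and parallel edges are allowed.
\<close>

definition row_finite :: "('a, 'b) pre_digraph \<Rightarrow> bool" where
  "row_finite G \<longleftrightarrow> (\<forall>v \<in> verts G. finite (out_arcs G v))"

text \<open>The vertices satisfying \<open>0 < |s\<inverse>(v)| < \<infinity>\<close>.\<close>

definition regular_vertex :: "('a, 'b) pre_digraph \<Rightarrow> 'a \<Rightarrow> bool" where
  "regular_vertex G v \<longleftrightarrow> v \<in> verts G \<and> finite (out_arcs G v) \<and> out_arcs G v \<noteq> {}"

text \<open>
  The empty walk accounts for the case \<open>v = w\<close>; the nonempty walks are exactly the paths
  \<open>e\<^sub>1 \<dots> e\<^sub>n\<close> with \<open>r(e\<^sub>i) = s(e\<^sub>i\<^sub>+\<^sub>1)\<close>.
\<close>

definition vertex_ge :: "('a, 'b) pre_digraph \<Rightarrow> 'a \<Rightarrow> 'a \<Rightarrow> bool" where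
  "vertex_ge G v w \<longleftrightarrow> (\<exists>p. pre_digraph.awalk G v p w)"

definition hereditary :: "('a, 'b) pre_digraph \<Rightarrow> 'a set \<Rightarrow> bool" where
  "hereditary G H \<longleftrightarrow> H \<subseteq> verts G \<and> (\<forall>w \<in> H. \<forall>v. vertex_ge G w v \<longrightarrow> v \<in> H)"

definition saturated :: "('a, 'b) pre_digraph \<Rightarrow> 'a set \<Rightarrow> bool" where
  "saturated G H \<longleftrightarrow> H \<subseteq> verts G \<and>
     (\<forall>v. regular_vertex G v \<and> head G ` out_arcs G v \<subseteq> H \<longrightarrow> v \<in> H)"

definition hs_closure :: "('a, 'b) pre_digraph \<Rightarrow> 'a set \<Rightarrow> 'a set" where
  "hs_closure G X = (\<lambda>H. hereditary G H \<and> saturated G H) hull X"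


section \<open>Ideals of not necessarily unital algebras\<close>

text \<open>
  Algebras over the field \<open>'k\<close> are represented by the record \<^typ>\<open>('k, 'x) module\<close>. They need not
  have a unit: the field \<open>one\<close> of the record is never used and is left unspecified.
\<close>

definition two_sided_ideal :: "('k, 'x) module \<Rightarrow> 'x set \<Rightarrow> bool" where
  "two_sided_ideal A I \<longleftrightarrow> additive_subgroup I A \<and>
     (\<forall>c. \<forall>x \<in> I. c \<odot>\<^bsub>A\<^esub> x \<in> I) \<and>
     (\<forall>a \<in> carrier A. \<forall>x \<in> I. a \<otimes>\<^bsub>A\<^esub> x \<in> I \<and> x \<otimes>\<^bsub>A\<^esub> a \<in> I)"

text \<open>
  \<open>D n\<close> is the homogeneous component of degree \<open>n\<close> of \<open>A\<close>; an ideal \<open>I\<close> is graded if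
  \<open>I = (\<Sum>n. I \<inter> D n)\<close>.
\<close>

definition graded_ideal :: "('k, 'x) module \<Rightarrow> (int \<Rightarrow> 'x set) \<Rightarrow> 'x set \<Rightarrow> bool" where
  "graded_ideal A D I \<longleftrightarrow> two_sided_ideal A I \<and>
     (\<forall>x \<in> I. \<exists>N f. finite N \<and> (\<forall>n \<in> N. f n \<in> I \<inter> D n) \<and> x = (\<Oplus>\<^bsub>A\<^esub>n \<in> N. f n))"

definition quotient_algebra :: "('k, 'x) module \<Rightarrow> 'x set \<Rightarrow> ('k, 'x set) module" where
  "quotient_algebra A J =
     \<lparr>carrier = a_rcosets\<^bsub>A\<^esub> J, mult = rcoset_mult A J, one = undefined,
      zero = J, add = set_add A, smult = (\<lambda>c X. \<Union>x \<in> X. J +>\<^bsub>A\<^esub> (c \<odot>\<^bsub>A\<^esub> x))\<rparr>"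

definition satisfies_acc :: "'x set set \<Rightarrow> bool" where
  "satisfies_acc \<F> \<longleftrightarrow> (\<forall>C :: nat \<Rightarrow> 'x set. (\<forall>n. C n \<in> \<F> \<and> C n \<subseteq> C (Suc n)) \<longrightarrow>
     (\<exists>N. \<forall>n \<ge> N. C n = C N))"


section \<open>Leavitt path algebras\<close>

text \<open>
  With lists as the free monoid under concatenation, \<open>'g list \<Rightarrow>\<^sub>0 'k\<close> with its convolution product
  is the free unital associative algebra on \<open>'g\<close>.
\<close>

instantiation list :: (type) monoid_add
begin

definition zero_list :: "'a list" where "zero_list = []"

definition plus_list :: "'a list \<Rightarrow> 'a list \<Rightarrow> 'a list" where "plus_list = (@)"

instance
  by intro_classes (simp_all add: zero_list_def plus_list_def)

end

datatype ('a, 'b) lpa_gen = Vertex 'a | Edge 'b | Ghost 'b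

definition lpa_gens :: "('a, 'b) pre_digraph \<Rightarrow> ('a, 'b) lpa_gen set" where
  "lpa_gens G = Vertex ` verts G \<union> Edge ` arcs G \<union> Ghost ` arcs G"

type_synonym ('k, 'a, 'b) free_elem = "('a, 'b) lpa_gen list \<Rightarrow>\<^sub>0 'k"

text \<open>
  The free non-unital algebra on the generators of \<open>G\<close>: linear combinations of nonempty words.
  The argument of type \<open>'k itself\<close> only serves to fix the field.
\<close>

definition free_lpa ::
    "'k::field itself \<Rightarrow> ('a, 'b) pre_digraph \<Rightarrow> ('k, ('k, 'a, 'b) free_elem) module" where
  "free_lpa K G =
     \<lparr>carrier = {p. \<forall>w \<in> Poly_Mapping.keys p. w \<noteq> [] \<and> set w \<subseteq> lpa_gens G},
      mult = (*), one = undefined, zero = 0, add = (+),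
      smult = (\<lambda>c. Poly_Mapping.map ((*) c))\<rparr>"

abbreviation gen :: "('a, 'b) lpa_gen \<Rightarrow> ('k::field, 'a, 'b) free_elem" where
  "gen g \<equiv> Poly_Mapping.single [g] 1"

definition lpa_relators ::
    "'k::field itself \<Rightarrow> ('a, 'b) pre_digraph \<Rightarrow> ('k, 'a, 'b) free_elem set" where
  "lpa_relators K G =
     {gen (Vertex v) * gen (Vertex w) - (if v = w then gen (Vertex v) else 0) | v w.
        v \<in> verts G \<and> w \<in> verts G} \<union>
     {gen (Vertex (tail G e)) * gen (Edge e) - gen (Edge e) | e. e \<in> arcs G} \<union>
     {gen (Edge e) * gen (Vertex (head G e)) - gen (Edge e) | e. e \<in> arcs G} \<union>
     {gen (Vertex (head G e)) * gen (Ghost e) - gen (Ghost e) | e. e \<in> arcs G} \<union>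
     {gen (Ghost e) * gen (Vertex (tail G e)) - gen (Ghost e) | e. e \<in> arcs G} \<union>
     {gen (Ghost e) * gen (Edge f) - (if e = f then gen (Vertex (head G e)) else 0) | e f.
        e \<in> arcs G \<and> f \<in> arcs G} \<union>
     {gen (Vertex v) - (\<Sum>e \<in> out_arcs G v. gen (Edge e) * gen (Ghost e)) | v.
        regular_vertex G v}"

definition lpa_ideal ::
    "'k::field itself \<Rightarrow> ('a, 'b) pre_digraph \<Rightarrow> ('k, 'a, 'b) free_elem set" where
  "lpa_ideal K G = two_sided_ideal (free_lpa K G) hull lpa_relators K G"

definition lpa ::
    "'k::field itself \<Rightarrow> ('a, 'b) pre_digraph \<Rightarrow> ('k, ('k, 'a, 'b) free_elem set) module" where
  "lpa K G = quotient_algebra (free_lpa K G) (lpa_ideal K G)"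

fun gen_degree :: "('a, 'b) lpa_gen \<Rightarrow> int" where
  "gen_degree (Vertex v) = 0"
| "gen_degree (Edge e) = 1"
| "gen_degree (Ghost e) = - 1"

text \<open>The image in \<open>lpa K G\<close> of the linear span of the words of degree \<open>n\<close>.\<close>

definition lpa_component ::
    "'k::field itself \<Rightarrow> ('a, 'b) pre_digraph \<Rightarrow> int \<Rightarrow> ('k, 'a, 'b) free_elem set set" where
  "lpa_component K G n =
     (\<lambda>p. lpa_ideal K G +>\<^bsub>free_lpa K G\<^esub> p) `
       {p \<in> carrier (free_lpa K G).
          \<forall>w \<in> Poly_Mapping.keys p. (\<Sum>g \<leftarrow> w. gen_degree g) = n}"

end

theory Submission
  imports Defs "HOL-Computational_Algebra.Polynomial" "HOL-Library.Sublist"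
begin

text \<open>
  Ideals of \<open>L\<^sub>K(E)\<close> are treated as ideals \<open>J\<close> of the free algebra that contain the relators.
  For (2) \<open>\<Longrightarrow>\<close> (3), a hereditary saturated set \<open>H\<close> generates a graded ideal, and a representation
  of \<open>E/H\<close> on functions shows that this ideal contains no vertex outside \<open>H\<close>.

  For (3) \<open>\<Longrightarrow>\<close> (1), the vertices contained in the members of an ascending chain eventually form a
  fixed set \<open>H\<close>. Let \<open>J \<subseteq> J'\<close> be later members of the chain and \<open>y \<in> J'\<close>. Right multiplication by long paths
  removes all ghost edges from \<open>y\<close>, and stripping edges from the left then leads to combinations
  \<open>p\<close> of closed paths at a single vertex \<open>v \<notin> H\<close> in which the trivial path occurs. If \<open>c\<close> is a
  shortest closed path at \<open>v\<close> and \<open>d\<close> is a path that leaves the powers of \<open>c\<close> and ends outside \<open>H\<close>, then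
  \<open>(c\<^sup>n d)\<^sup>* p (c\<^sup>n d)\<close> is a nonzero multiple of the vertex \<open>r(d)\<close> for large \<open>n\<close>, a contradiction. Otherwise \<open>v\<close>
  lies on a cycle without exit in \<open>E/H\<close> and \<open>p\<close> is a polynomial in \<open>c\<close>. There are only finitely many such
  cycles by (3), and the ideals of \<open>K[x]\<close> satisfy the ascending chain condition.
\<close>

section \<open>Monomials of the free algebra\<close>

text \<open>The chain condition is proved in implication form: if certain special elements of
  \<open>J'\<close> lie in \<open>J\<close>, then all of \<open>J'\<close> does. Nonmembership in an
  ideal has to be shown only for vertices outside \<open>H\<close>, where a representation decides
  it. In general there is no unit; vertices take its place, and the summation relation
  \<open>v = \<Sum> e e^*\<close> is read as a descent: if all \<open>e^* p\<close> (or all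
  \<open>p e\<close>) lie in \<open>J\<close>, so does \<open>v p\<close> (or \<open>p v\<close>).
  Row-finiteness makes this relation available at every vertex that is not a sink. The path
  \<open>\<mu> = c^n d\<close> is chosen so that \<open>\<mu>^* q \<mu>\<close> vanishes for each
  nontrivial closed path \<open>q\<close> in \<open>p\<close>: otherwise \<open>\<mu>\<close> would
  be a prefix of \<open>q \<mu>\<close>, which forces \<open>q\<close> to be a power of
  \<open>c\<close> and then \<open>d\<close> to be a prefix of such a power. Absence of exits is
  expressed by comparability of paths in the prefix order. It makes closed paths at \<open>v\<close>
  commute, and this permits a change of base point along a cycle. As the ghost edges are gone by
  then, ordinary polynomials in \<open>x\<close> take the place of Laurent polynomials.\<close>

abbreviation mon :: "'g list \<Rightarrow> 'g list \<Rightarrow>\<^sub>0 'k::field" where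
  "mon w \<equiv> Poly_Mapping.single w 1"

text \<open>Scalars become factors supported on the empty word, so that linear combinations are
  computed in a single ring. A nonzero \<open>scal c\<close> lies outside
  \<open>carrier (free_lpa K G)\<close>, hence closure under scalars is a separate clause for
  ideals.\<close>

abbreviation scal :: "'k::field \<Rightarrow> 'g list \<Rightarrow>\<^sub>0 'k" where
  "scal c \<equiv> Poly_Mapping.single [] c"

lemma single_mult_single:
  "Poly_Mapping.single u a * Poly_Mapping.single w b = Poly_Mapping.single (u @ w) (a * b :: 'k::field)"
  by (simp add: mult_single plus_list_def)

lemma single_conv_scal: "Poly_Mapping.single w c = scal c * mon w"
  by (simp add: single_mult_single)

lemma mon_Nil: "mon [] = 1"
  by (metis single_one zero_list_def)

lemma scal_1 [simp]: "scal 1 = 1"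
  by (rule mon_Nil)

lemma sum_monomials:
  "p = (\<Sum>w\<in>Poly_Mapping.keys p. Poly_Mapping.single w (Poly_Mapping.lookup p w))"
proof (rule poly_mapping_eqI)
  fix w
  show "Poly_Mapping.lookup p w =
    Poly_Mapping.lookup (\<Sum>w\<in>Poly_Mapping.keys p. Poly_Mapping.single w (Poly_Mapping.lookup p w)) w"
    by (auto simp: lookup_sum lookup_single when_def in_keys_iff)
qed

lemma scal_commute: "scal c * p = p * scal (c :: 'k::field)"
proof -
  have "scal c * (\<Sum>w\<in>Poly_Mapping.keys p. Poly_Mapping.single w (Poly_Mapping.lookup p w)) =
    (\<Sum>w\<in>Poly_Mapping.keys p. Poly_Mapping.single w (Poly_Mapping.lookup p w)) * scal c"
    by (simp add: sum_distrib_left sum_distrib_right single_mult_single mult.commute)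
  then show ?thesis
    by (simp flip: sum_monomials)
qed

lemma keys_sum_subset: "Poly_Mapping.keys (sum f A) \<subseteq> (\<Union>x\<in>A. Poly_Mapping.keys (f x))"
  by (induct A rule: infinite_finite_induct) (use keys_add in fastforce)+

lemma keys_scal_mult: "Poly_Mapping.keys (scal c * p) \<subseteq> Poly_Mapping.keys p"
  using keys_mult[of "scal c" p] by (auto simp: plus_list_def split: if_splits)

lemma keys_minus_subset:
  "Poly_Mapping.keys (p - q) \<subseteq> Poly_Mapping.keys p \<union> Poly_Mapping.keys (q :: 'g \<Rightarrow>\<^sub>0 'k::field)"
  by (auto simp: in_keys_iff lookup_minus)

section \<open>Ideals of the free algebra\<close>

lemma free_lpa_simps [simp]:
  "ring.zero (free_lpa K G) = 0" "ring.add (free_lpa K G) = (+)" "monoid.mult (free_lpa K G) = (*)"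
  "module.smult (free_lpa K G) c p = scal c * p"
  by (auto simp: free_lpa_def mult_map_scale_conv_mult zero_list_def)

lemma carrier_free_lpa:
  "p \<in> carrier (free_lpa K G) \<longleftrightarrow> (\<forall>w\<in>Poly_Mapping.keys p. w \<noteq> [] \<and> set w \<subseteq> lpa_gens G)"
  by (simp add: free_lpa_def)

lemma zero_carrier_free_lpa: "0 \<in> carrier (free_lpa K G)"
  by (simp add: carrier_free_lpa)

lemma carrier_free_lpa_sum:
  "(\<And>x. x \<in> A \<Longrightarrow> f x \<in> carrier (free_lpa K G)) \<Longrightarrow> sum f A \<in> carrier (free_lpa K G)"
  using keys_sum_subset[of f A] unfolding carrier_free_lpa by blast

lemma carrier_free_lpa_add:
  "p \<in> carrier (free_lpa K G) \<Longrightarrow> q \<in> carrier (free_lpa K G) \<Longrightarrow> p + q \<in> carrier (free_lpa K G)"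
  using keys_add[of p q] unfolding carrier_free_lpa by blast

lemma carrier_free_lpa_uminus:
  "p \<in> carrier (free_lpa K G) \<Longrightarrow> - p \<in> carrier (free_lpa K G)"
  unfolding carrier_free_lpa by (simp add: in_keys_iff)

lemma carrier_free_lpa_minus:
  "p \<in> carrier (free_lpa K G) \<Longrightarrow> q \<in> carrier (free_lpa K G) \<Longrightarrow> p - q \<in> carrier (free_lpa K G)"
  using keys_minus_subset[of p q] unfolding carrier_free_lpa by blast

lemma carrier_free_lpa_mon:
  "w \<noteq> [] \<Longrightarrow> set w \<subseteq> lpa_gens G \<Longrightarrow> mon w \<in> carrier (free_lpa K G)"
  by (simp add: carrier_free_lpa)

lemma carrier_free_lpa_mult:
  assumes "p \<in> carrier (free_lpa K G)" "q \<in> carrier (free_lpa K G)"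
  shows "p * q \<in> carrier (free_lpa K G)"
  unfolding carrier_free_lpa
proof
  fix w assume "w \<in> Poly_Mapping.keys (p * q)"
  then obtain u v where "u \<in> Poly_Mapping.keys p" "v \<in> Poly_Mapping.keys q" "w = u @ v"
    using keys_mult[of p q] by (auto simp: plus_list_def)
  then show "w \<noteq> [] \<and> set w \<subseteq> lpa_gens G"
    using assms unfolding carrier_free_lpa by auto
qed

lemma abelian_group_free_lpa: "abelian_group (free_lpa K G)"
proof (rule abelian_groupI)
  fix x assume "x \<in> carrier (free_lpa K G)"
  then show "\<exists>y\<in>carrier (free_lpa K G). y \<oplus>\<^bsub>free_lpa K G\<^esub> x = \<zero>\<^bsub>free_lpa K G\<^esub>"
    by (intro bexI[of _ "- x"]) (auto intro: carrier_free_lpa_uminus)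
qed (auto simp: carrier_free_lpa_add algebra_simps, simp add: carrier_free_lpa)

lemma a_inv_free_lpa:
  assumes "x \<in> carrier (free_lpa K G)"
  shows "\<ominus>\<^bsub>free_lpa K G\<^esub> x = - x"
proof -
  interpret abelian_group "free_lpa K G" by (rule abelian_group_free_lpa)
  show ?thesis
    by (rule minus_equality) (use assms in \<open>auto intro: carrier_free_lpa_uminus\<close>)
qed

lemma additive_subgroup_free_lpa:
  assumes "J \<subseteq> carrier (free_lpa K G)" "0 \<in> J" "\<And>x y. x \<in> J \<Longrightarrow> y \<in> J \<Longrightarrow> x + y \<in> J"
    "\<And>x. x \<in> J \<Longrightarrow> - x \<in> J"
  shows "additive_subgroup J (free_lpa K G)"
proof -
  have "inv\<^bsub>add_monoid (free_lpa K G)\<^esub> x = - x" if "x \<in> J" for x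
    using a_inv_free_lpa[of x K G] that assms(1) unfolding a_inv_def by auto
  then show ?thesis
    using assms by (auto intro!: additive_subgroup.intro subgroup.intro)
qed

lemma free_idealD:
  assumes "two_sided_ideal (free_lpa K G) J"
  shows "J \<subseteq> carrier (free_lpa K G)" "0 \<in> J" "x \<in> J \<Longrightarrow> y \<in> J \<Longrightarrow> x + y \<in> J"
    "x \<in> J \<Longrightarrow> scal c * x \<in> J"
    "x \<in> J \<Longrightarrow> - x \<in> J"
    "x \<in> J \<Longrightarrow> y \<in> J \<Longrightarrow> x - y \<in> J"
    "x \<in> J \<Longrightarrow> a \<in> carrier (free_lpa K G) \<Longrightarrow> a * x \<in> J"
    "x \<in> J \<Longrightarrow> a \<in> carrier (free_lpa K G) \<Longrightarrow> x * a \<in> J"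
    "x \<in> J \<Longrightarrow> set w \<subseteq> lpa_gens G \<Longrightarrow> mon w * x \<in> J"
    "x \<in> J \<Longrightarrow> set w \<subseteq> lpa_gens G \<Longrightarrow> x * mon w \<in> J"
    "(\<And>i. i \<in> A \<Longrightarrow> f i \<in> J) \<Longrightarrow> sum f A \<in> J"
proof -
  interpret additive_subgroup J "free_lpa K G"
    using assms by (simp add: two_sided_ideal_def)
  show "J \<subseteq> carrier (free_lpa K G)" by (rule a_subset)
  show zero: "0 \<in> J" using zero_closed by simp
  have sc: "x \<in> J \<Longrightarrow> scal c * x \<in> J" for x c
    using assms by (auto simp: two_sided_ideal_def)
  then show "x \<in> J \<Longrightarrow> scal c * x \<in> J" .
  have add: "x \<in> J \<Longrightarrow> y \<in> J \<Longrightarrow> x + y \<in> J" for x y using a_closed by simp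
  then show "x \<in> J \<Longrightarrow> y \<in> J \<Longrightarrow> x + y \<in> J" .
  have m: "x \<in> J \<Longrightarrow> - x \<in> J" for x
    using sc[of x "- 1"] by (simp add: single_uminus)
  then show "x \<in> J \<Longrightarrow> - x \<in> J" .
  show "x \<in> J \<Longrightarrow> y \<in> J \<Longrightarrow> x - y \<in> J"
    using add[OF _ m, of x y] by simp
  have l: "x \<in> J \<Longrightarrow> a \<in> carrier (free_lpa K G) \<Longrightarrow> a * x \<in> J" for a
    using assms by (auto simp: two_sided_ideal_def)
  then show "x \<in> J \<Longrightarrow> a \<in> carrier (free_lpa K G) \<Longrightarrow> a * x \<in> J" .
  have r: "x \<in> J \<Longrightarrow> a \<in> carrier (free_lpa K G) \<Longrightarrow> x * a \<in> J" for a
    using assms by (auto simp: two_sided_ideal_def)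
  then show "x \<in> J \<Longrightarrow> a \<in> carrier (free_lpa K G) \<Longrightarrow> x * a \<in> J" .
  show "x \<in> J \<Longrightarrow> set w \<subseteq> lpa_gens G \<Longrightarrow> mon w * x \<in> J"
    using l[OF _ carrier_free_lpa_mon, of w] by (cases "w = []") auto
  show "x \<in> J \<Longrightarrow> set w \<subseteq> lpa_gens G \<Longrightarrow> x * mon w \<in> J"
    using r[OF _ carrier_free_lpa_mon, of w] by (cases "w = []") auto
  show "(\<And>i. i \<in> A \<Longrightarrow> f i \<in> J) \<Longrightarrow> sum f A \<in> J"
    by (induct A rule: infinite_finite_induct) (auto intro: zero add)
qed

text \<open>Elements of the carrier are linear combinations of nonempty words, so absorption can be
  checked on monomials.\<close>

lemma free_idealI:
  assumes sub: "J \<subseteq> carrier (free_lpa K G)" and zero: "0 \<in> J"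
    and add: "\<And>x y. x \<in> J \<Longrightarrow> y \<in> J \<Longrightarrow> x + y \<in> J"
    and scal: "\<And>x c. x \<in> J \<Longrightarrow> scal c * x \<in> J"
    and left: "\<And>x w. x \<in> J \<Longrightarrow> w \<noteq> [] \<Longrightarrow> set w \<subseteq> lpa_gens G \<Longrightarrow> mon w * x \<in> J"
    and right: "\<And>x w. x \<in> J \<Longrightarrow> w \<noteq> [] \<Longrightarrow> set w \<subseteq> lpa_gens G \<Longrightarrow> x * mon w \<in> J"
  shows "two_sided_ideal (free_lpa K G) J"
proof -
  have sum: "(\<And>i. i \<in> A \<Longrightarrow> f i \<in> J) \<Longrightarrow> sum f A \<in> J" for f :: "_ \<Rightarrow> _" and A
    by (induct A rule: infinite_finite_induct) (auto intro: zero add)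
  have l: "a * x \<in> J" and r: "x * a \<in> J" if a: "a \<in> carrier (free_lpa K G)" and x: "x \<in> J" for a x
  proof -
    have "a * x = (\<Sum>w\<in>Poly_Mapping.keys a. scal (Poly_Mapping.lookup a w) * (mon w * x))"
      by (subst sum_monomials[of a])
        (simp add: sum_distrib_right single_mult_single flip: mult.assoc)
    also have "\<dots> \<in> J"
      by (rule sum) (use a x in \<open>auto simp: carrier_free_lpa intro!: scal left\<close>)
    finally show "a * x \<in> J" .
    have "x * a = (\<Sum>w\<in>Poly_Mapping.keys a. scal (Poly_Mapping.lookup a w) * (x * mon w))"
      by (subst sum_monomials[of a])
        (simp add: sum_distrib_left single_mult_single scal_commute mult.assoc)
    also have "\<dots> \<in> J"
      by (rule sum) (use a x in \<open>auto simp: carrier_free_lpa intro!: scal right\<close>)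
    finally show "x * a \<in> J" .
  qed
  have "- x \<in> J" if "x \<in> J" for x
    using scal[OF that, of "- 1"] by (simp add: single_uminus)
  then show ?thesis
    unfolding two_sided_ideal_def
    using additive_subgroup_free_lpa[OF sub zero add] scal l r by auto
qed

lemma free_ideal_Inter:
  assumes "\<And>J. J \<in> F \<Longrightarrow> two_sided_ideal (free_lpa K G) J" "F \<noteq> {}"
  shows "two_sided_ideal (free_lpa K G) (\<Inter>F)"
proof (rule free_idealI)
  show "\<Inter>F \<subseteq> carrier (free_lpa K G)" using assms free_idealD(1) by fastforce
qed (use assms in \<open>auto intro!: free_idealD(2-4,9,10)\<close>)

lemma free_ideal_carrier: "two_sided_ideal (free_lpa K G) (carrier (free_lpa K G))"
proof (rule free_idealI)
  show "scal c * x \<in> carrier (free_lpa K G)" if "x \<in> carrier (free_lpa K G)" for x c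
    using that keys_scal_mult[of c x] unfolding carrier_free_lpa by auto
qed (auto intro: carrier_free_lpa_add carrier_free_lpa_mult carrier_free_lpa_mon simp: zero_carrier_free_lpa)

lemma free_ideal_hull:
  assumes "S \<subseteq> carrier (free_lpa K G)"
  shows "two_sided_ideal (free_lpa K G) (two_sided_ideal (free_lpa K G) hull S)"
  unfolding hull_def
  by (rule free_ideal_Inter) (use free_ideal_carrier assms in auto)

lemma (in wf_digraph) lpa_relators_carrier: "lpa_relators K G \<subseteq> carrier (free_lpa K G)"
proof -
  have m: "mon w \<in> carrier (free_lpa K G)" if "w \<noteq> []" "set w \<subseteq> lpa_gens G" for w
    using that by (rule carrier_free_lpa_mon)
  have s: "(\<Sum>e\<in>out_arcs G v. mon [Edge e, Ghost e]) \<in> carrier (free_lpa K G)" for v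
    by (rule carrier_free_lpa_sum) (auto intro!: m simp: lpa_gens_def)
  show ?thesis
    unfolding lpa_relators_def
    by (auto simp: single_mult_single regular_vertex_def intro!: carrier_free_lpa_minus m s zero_carrier_free_lpa)
      (auto simp: lpa_gens_def)
qed

section \<open>Words of walks\<close>

text \<open>The leading vertex makes the trivial path a nonempty word, hence an element of the
  non-unital algebra, and keeps trivial paths at different vertices apart.\<close>

definition walk_word :: "'a \<Rightarrow> 'b list \<Rightarrow> ('a, 'b) lpa_gen list" where
  "walk_word u q = Vertex u # map Edge q"

text \<open>The word of \<open>q^*\<close>; the order is reversed because
  \<open>(e f)^* = f^* e^*\<close>.\<close>

definition ghost_word :: "'b list \<Rightarrow> ('a, 'b) lpa_gen list" where
  "ghost_word q = map Ghost (rev q)"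

lemma walk_word_inject [simp]: "walk_word u q = walk_word u' q' \<longleftrightarrow> u = u' \<and> q = q'"
  by (auto simp: walk_word_def dest: map_injective[OF _ injI[where f = Edge]])

lemma lpa_gens_iff [simp]:
  "Vertex v \<in> lpa_gens G \<longleftrightarrow> v \<in> verts G"
  "Edge e \<in> lpa_gens G \<longleftrightarrow> e \<in> arcs G"
  "Ghost e \<in> lpa_gens G \<longleftrightarrow> e \<in> arcs G"
  by (auto simp: lpa_gens_def)

lemma lpa_relatorsI:
  shows "v \<in> verts G \<Longrightarrow> w \<in> verts G \<Longrightarrow>
    gen (Vertex v) * gen (Vertex w) - (if v = w then gen (Vertex v) else 0) \<in> lpa_relators K G"
    and "e \<in> arcs G \<Longrightarrow>
    gen (Vertex (tail G e)) * gen (Edge e) - gen (Edge e) \<in> lpa_relators K G"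
    and "e \<in> arcs G \<Longrightarrow>
    gen (Edge e) * gen (Vertex (head G e)) - gen (Edge e) \<in> lpa_relators K G"
    and "e \<in> arcs G \<Longrightarrow>
    gen (Vertex (head G e)) * gen (Ghost e) - gen (Ghost e) \<in> lpa_relators K G"
    and "e \<in> arcs G \<Longrightarrow>
    gen (Ghost e) * gen (Vertex (tail G e)) - gen (Ghost e) \<in> lpa_relators K G"
    and "e \<in> arcs G \<Longrightarrow> f \<in> arcs G \<Longrightarrow>
    gen (Ghost e) * gen (Edge f) - (if e = f then gen (Vertex (head G e)) else 0) \<in> lpa_relators K G"
    and "regular_vertex G v \<Longrightarrow>
    gen (Vertex v) - (\<Sum>e \<in> out_arcs G v. gen (Edge e) * gen (Ghost e)) \<in> lpa_relators K G"
  unfolding lpa_relators_def Un_iff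
  subgoal by (rule disjI1, rule disjI1, rule disjI1, rule disjI1, rule disjI1, rule disjI1, rule CollectI, rule exI, rule exI, rule conjI, rule refl, rule conjI, assumption, assumption)
  subgoal by (rule disjI1, rule disjI1, rule disjI1, rule disjI1, rule disjI1, rule disjI2, rule CollectI, rule exI, rule conjI, rule refl, assumption)
  subgoal by (rule disjI1, rule disjI1, rule disjI1, rule disjI1, rule disjI2, rule CollectI, rule exI, rule conjI, rule refl, assumption)
  subgoal by (rule disjI1, rule disjI1, rule disjI1, rule disjI2, rule CollectI, rule exI, rule conjI, rule refl, assumption)
  subgoal by (rule disjI1, rule disjI1, rule disjI2, rule CollectI, rule exI, rule conjI, rule refl, assumption)
  subgoal by (rule disjI1, rule disjI2, rule CollectI, rule exI, rule exI, rule conjI, rule refl, rule conjI, assumption, assumption)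
  subgoal by (rule disjI2, rule CollectI, rule exI, rule conjI, rule refl, assumption)
  done

context wf_digraph
begin

lemma awalk_splitE:
  assumes "awalk u (p @ q) v"
  obtains w where "awalk u p w" "awalk w q v"
  using assms by auto

lemma awalk_arcs: "awalk u q v \<Longrightarrow> set q \<subseteq> arcs G"
  by (simp add: awalk_def)

lemma set_map_Edge: "awalk u q v \<Longrightarrow> Edge ` set q \<subseteq> lpa_gens G"
  using awalk_arcs[of u q v] by auto

lemma set_walk_word: "awalk u q v \<Longrightarrow> set (walk_word u q) \<subseteq> lpa_gens G"
  using awalk_arcs[of u q v] awalk_hd_in_verts[of u q v] by (auto simp: walk_word_def)

lemma set_ghost_word: "awalk u q v \<Longrightarrow> set (ghost_word q) \<subseteq> lpa_gens G"
  using awalk_arcs[of u q v] by (auto simp: ghost_word_def)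

end

section \<open>Words modulo an ideal that contains the relators\<close>

locale lpa_preideal = wf_digraph G for G :: "('a, 'b) pre_digraph" +
  fixes K :: "'k::field itself" and J :: "('k, 'a, 'b) free_elem set"
  assumes ideal: "two_sided_ideal (free_lpa K G) J"
    and relators: "lpa_relators K G \<subseteq> J"
begin

lemmas J_sub = free_idealD(1)[OF ideal]
lemmas J_zero = free_idealD(2)[OF ideal]
lemmas J_add = free_idealD(3)[OF ideal]
lemmas J_scal = free_idealD(4)[OF ideal]
lemmas J_uminus = free_idealD(5)[OF ideal]
lemmas J_minus = free_idealD(6)[OF ideal]
lemmas J_mon_left = free_idealD(9)[OF ideal]
lemmas J_mon_right = free_idealD(10)[OF ideal]
lemmas J_sum = free_idealD(11)[OF ideal]

lemma J_mem_cong: "x - y \<in> J \<Longrightarrow> x \<in> J \<longleftrightarrow> y \<in> J"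
  using J_add[of "x - y" y] J_minus[of x "x - y"] by auto

text \<open>Every product needed later reduces either to a single word or to zero. Calculations are
  therefore done with words and carried over to linear combinations by
  \<open>linear_lift\<close>.\<close>

definition word_cong :: "('a, 'b) lpa_gen list \<Rightarrow> ('a, 'b) lpa_gen list \<Rightarrow> bool" where
  "word_cong w w' \<longleftrightarrow> mon w - mon w' \<in> J"

definition word_zero :: "('a, 'b) lpa_gen list \<Rightarrow> bool" where
  "word_zero w \<longleftrightarrow> mon w \<in> J"

lemma word_cong_refl [simp]: "word_cong w w"
  by (simp add: word_cong_def J_zero)

lemma word_cong_sym: "word_cong w w' \<Longrightarrow> word_cong w' w"
  using J_uminus[of "mon w - mon w'"] by (simp add: word_cong_def)

lemma word_cong_trans [trans]: "word_cong u v \<Longrightarrow> word_cong v w \<Longrightarrow> word_cong u w"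
  using J_add[of "mon u - mon v" "mon v - mon w"] by (simp add: word_cong_def)

lemma word_cong_zero_iff: "word_cong w w' \<Longrightarrow> word_zero w \<longleftrightarrow> word_zero w'"
  by (simp add: word_cong_def word_zero_def J_mem_cong)

lemma word_zero_ctx: "word_zero w \<Longrightarrow> set a \<subseteq> lpa_gens G \<Longrightarrow> set b \<subseteq> lpa_gens G \<Longrightarrow> word_zero (a @ w @ b)"
  using J_mon_right[OF J_mon_left, of "mon w" a b] by (simp add: word_zero_def single_mult_single)

lemma word_cong_ctx: "word_cong w w' \<Longrightarrow> set a \<subseteq> lpa_gens G \<Longrightarrow> set b \<subseteq> lpa_gens G \<Longrightarrow> word_cong (a @ w @ b) (a @ w' @ b)"
  using J_mon_right[OF J_mon_left, of "mon w - mon w'" a b]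
  by (simp add: word_cong_def single_mult_single algebra_simps)

lemmas word_zero_left = word_zero_ctx[where b = "[]", simplified]
lemmas word_zero_right = word_zero_ctx[where a = "[]", simplified]
lemmas word_cong_left = word_cong_ctx[where b = "[]", simplified]
lemmas word_cong_right = word_cong_ctx[where a = "[]", simplified]

lemma word_cong_vertex_vertex: "v \<in> verts G \<Longrightarrow> word_cong [Vertex v, Vertex v] [Vertex v]"
  using relators lpa_relatorsI(1)[of v G v K] by (auto simp: word_cong_def single_mult_single)

lemma word_zero_vertex_vertex: "v \<in> verts G \<Longrightarrow> w \<in> verts G \<Longrightarrow> v \<noteq> w \<Longrightarrow> word_zero [Vertex v, Vertex w]"
  using relators lpa_relatorsI(1)[of v G w K] by (auto simp: word_zero_def single_mult_single)

lemma word_cong_tail_edge: "e \<in> arcs G \<Longrightarrow> word_cong [Vertex (tail G e), Edge e] [Edge e]"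
  using relators lpa_relatorsI(2)[of e G K] by (auto simp: word_cong_def single_mult_single)

lemma word_cong_edge_head: "e \<in> arcs G \<Longrightarrow> word_cong [Edge e, Vertex (head G e)] [Edge e]"
  using relators lpa_relatorsI(3)[of e G K] by (auto simp: word_cong_def single_mult_single)

lemma word_cong_ghost_tail: "e \<in> arcs G \<Longrightarrow> word_cong [Ghost e, Vertex (tail G e)] [Ghost e]"
  using relators lpa_relatorsI(5)[of e G K] by (auto simp: word_cong_def single_mult_single)

lemma word_cong_ghost_edge: "e \<in> arcs G \<Longrightarrow> word_cong [Ghost e, Edge e] [Vertex (head G e)]"
  using relators lpa_relatorsI(6)[of e G e K] by (auto simp: word_cong_def single_mult_single)

lemma word_zero_ghost_edge: "e \<in> arcs G \<Longrightarrow> f \<in> arcs G \<Longrightarrow> e \<noteq> f \<Longrightarrow> word_zero [Ghost e, Edge f]"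
  using relators lpa_relatorsI(6)[of e G f K] by (auto simp: word_zero_def single_mult_single)

lemma regular_vertex_relator:
  assumes "regular_vertex G v"
  shows "mon [Vertex v] - (\<Sum>e\<in>out_arcs G v. mon [Edge e, Ghost e]) \<in> J"
  using relators lpa_relatorsI(7)[of G v K] assms by (auto simp: word_zero_def single_mult_single)

lemma word_cong_vertex_walk:
  assumes "awalk u q v"
  shows "word_cong (Vertex u # walk_word u q) (walk_word u q)"
  using word_cong_right[OF word_cong_vertex_vertex, of u "map Edge q"] assms
  by (auto simp: walk_word_def set_map_Edge awalk_hd_in_verts)

lemma word_zero_vertex_walk:
  assumes "awalk u q v" "w \<in> verts G" "w \<noteq> u"
  shows "word_zero (Vertex w # walk_word u q)"
  using word_zero_right[OF word_zero_vertex_vertex, of w u "map Edge q"] assms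
  by (auto simp: walk_word_def set_map_Edge awalk_hd_in_verts)

lemma word_cong_edge_walk:
  assumes "awalk u q v" "e \<in> arcs G" "head G e = u"
  shows "word_cong (Edge e # walk_word u q) (walk_word (tail G e) (e # q))"
proof -
  have s: "set (map Edge q) \<subseteq> lpa_gens G"
    using assms set_map_Edge[OF assms(1)] by auto
  from word_cong_right[OF word_cong_edge_head[OF assms(2)] s] word_cong_sym[OF word_cong_right[OF word_cong_tail_edge[OF assms(2)] s]]
  show ?thesis using assms(3) by (auto simp: walk_word_def intro: word_cong_trans)
qed

lemma word_zero_edge_walk:
  assumes "awalk u q v" "e \<in> arcs G" "head G e \<noteq> u"
  shows "word_zero (Edge e # walk_word u q)"
proof -
  have s: "set (walk_word u q) \<subseteq> lpa_gens G" "Edge e \<in> lpa_gens G"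
    using assms set_walk_word[OF assms(1)] by auto
  have "word_zero (Edge e # Vertex (head G e) # walk_word u q)"
    using word_zero_left[OF word_zero_vertex_walk, of u q v "head G e" "[Edge e]"] assms s by auto
  then show ?thesis
    using word_cong_zero_iff[OF word_cong_right[OF word_cong_edge_head s(1)], of e] assms by simp
qed

lemma word_zero_ghost_walk:
  assumes "awalk u q v" "e \<in> arcs G" "tail G e \<noteq> u"
  shows "word_zero (Ghost e # walk_word u q)"
proof -
  have s: "set (walk_word u q) \<subseteq> lpa_gens G" "Ghost e \<in> lpa_gens G"
    using assms set_walk_word[OF assms(1)] by auto
  have "word_zero (Ghost e # Vertex (tail G e) # walk_word u q)"
    using word_zero_left[OF word_zero_vertex_walk, of u q v "tail G e" "[Ghost e]"] assms s by auto
  then show ?thesis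
    using word_cong_zero_iff[OF word_cong_right[OF word_cong_ghost_tail s(1)], of e] assms by simp
qed

lemma ghost_walk_Cons:
  assumes "awalk u (f # q) v" "e \<in> arcs G"
  shows "e = f \<Longrightarrow> word_cong (Ghost e # walk_word u (f # q)) (walk_word (head G f) q)"
    and "e \<noteq> f \<Longrightarrow> word_zero (Ghost e # walk_word u (f # q))"
proof -
  have u: "u = tail G f" and f: "f \<in> arcs G" and q: "awalk (head G f) q v"
    using assms by (auto simp: awalk_Cons_iff)
  have s: "set (map Edge q) \<subseteq> lpa_gens G" "Ghost e \<in> lpa_gens G"
    using assms(2) set_map_Edge[OF q] by auto
  have 1: "word_cong (Ghost e # walk_word u (f # q)) (Ghost e # Edge f # map Edge q)"
    using word_cong_ctx[OF word_cong_tail_edge[OF f], of "[Ghost e]" "map Edge q"] s by (simp add: walk_word_def u)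
  show "word_cong (Ghost e # walk_word u (f # q)) (walk_word (head G f) q)" if "e = f"
    using word_cong_trans[OF 1] word_cong_right[OF word_cong_ghost_edge[OF f] s(1)] that by (simp add: walk_word_def)
  show "word_zero (Ghost e # walk_word u (f # q))" if "e \<noteq> f"
    using word_cong_zero_iff[OF 1] word_zero_right[OF word_zero_ghost_edge[OF assms(2) f that] s(1)] by simp
qed

lemma word_cong_walk_vertex:
  assumes "awalk u q v"
  shows "word_cong (walk_word u q @ [Vertex v]) (walk_word u q)"
proof (cases q rule: rev_cases)
  case Nil
  then show ?thesis using assms word_cong_vertex_vertex by (auto simp: walk_word_def awalk_Nil_iff)
next
  case (snoc p e)
  then have e: "e \<in> arcs G" "head G e = v" and "set (walk_word u p) \<subseteq> lpa_gens G"
    using assms set_walk_word[of u p] unfolding snoc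
    by (metis awalk_splitE awalk_Cons_iff awalk_Nil_iff)+
  then show ?thesis
    using word_cong_left[OF word_cong_edge_head[of e], of "walk_word u p"] snoc by (simp add: walk_word_def)
qed

lemma word_cong_walk_walk:
  assumes "awalk u p v" "awalk v q w"
  shows "word_cong (walk_word u p @ walk_word v q) (walk_word u (p @ q))"
  using word_cong_right[OF word_cong_walk_vertex[OF assms(1)], of "map Edge q"] assms(2)
  by (auto simp: walk_word_def set_map_Edge awalk_hd_in_verts)

text \<open>The ghost of the first edge of \<open>q\<close> is the last letter of
  \<open>q^*\<close>, so \<open>e^* e = r(e)\<close> cancels \<open>q\<close> edge by edge from the
  front.\<close>

lemma word_cong_ghost_word:
  assumes "awalk u q m" "awalk m t v"
  shows "word_cong (ghost_word q @ walk_word u (q @ t)) (walk_word m t)"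
  using assms(1)
proof (induct q arbitrary: u)
  case Nil
  then show ?case by (simp add: ghost_word_def awalk_Nil_iff)
next
  case (Cons e q)
  then have e: "e \<in> arcs G" "u = tail G e" and q: "awalk (head G e) q m"
    by (auto simp: awalk_Cons_iff)
  have "awalk u (e # q @ t) v"
    using e awalk_appendI[OF q assms(2)] by (simp only: awalk_Cons_iff)
  then have "word_cong (ghost_word q @ Ghost e # walk_word u (e # q @ t)) (ghost_word q @ walk_word (head G e) (q @ t))"
    using word_cong_left[OF ghost_walk_Cons(1)[of u e "q @ t" v e] set_ghost_word[OF q]] e by simp
  then show ?case
    using word_cong_trans[OF _ Cons(1)[OF q]] by (simp add: ghost_word_def)
qed

text \<open>The first place where \<open>q\<close> and \<open>q'\<close> differ produces a factor
  \<open>e^* f = 0\<close>. The length bound excludes that \<open>q'\<close> is a proper prefix of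
  \<open>q\<close>, where a ghost path would remain.\<close>

lemma word_zero_ghost_word:
  assumes "awalk u q m" "awalk u q' v" "length q \<le> length q'" "\<not> prefix q q'"
  shows "word_zero (ghost_word q @ walk_word u q')"
  using assms
proof (induct q arbitrary: u q')
  case Nil
  then show ?case by simp
next
  case (Cons e q)
  then obtain f r where q': "q' = f # r" by (cases q') auto
  have e: "e \<in> arcs G" "u = tail G e" and q: "awalk (head G e) q m"
    using Cons.prems by (auto simp: awalk_Cons_iff)
  have r: "awalk (head G f) r v" using Cons.prems q' by (auto simp: awalk_Cons_iff)
  show ?case
  proof (cases "e = f")
    case True
    have "word_cong (ghost_word q @ Ghost e # walk_word u (f # r)) (ghost_word q @ walk_word (head G f) r)"
      using word_cong_left[OF ghost_walk_Cons(1)[of u f r v e] set_ghost_word[OF q]] e Cons.prems(2) q' True by simp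
    moreover have "word_zero (ghost_word q @ walk_word (head G f) r)"
      by (rule Cons.hyps) (use q r Cons.prems True q' in auto)
    ultimately show ?thesis using word_cong_zero_iff q' by (simp add: ghost_word_def)
  next
    case False
    then show ?thesis
      using word_zero_left[OF ghost_walk_Cons(2)[of u f r v e] set_ghost_word[OF q]] e Cons.prems(2) q'
      by (simp add: ghost_word_def)
  qed
qed

text \<open>Each ghost letter of \<open>w\<close> either kills the product or deletes the first edge
  of the walk, so a walk at least as long as \<open>w\<close> absorbs all ghost letters. If the walk
  is shorter, \<open>v\<close> is a sink, and a ghost edge meeting the trivial walk at a sink gives
  zero. The bound on \<open>length q'\<close> is the invariant of the induction.\<close>

lemma word_walk:
  assumes "set w \<subseteq> lpa_gens G" "awalk u q v" "length w \<le> length q \<or> out_arcs G v = {}"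
  shows "word_zero (w @ walk_word u q) \<or>
    (\<exists>u' q'. awalk u' q' v \<and> length q \<le> length q' + length w \<and> word_cong (w @ walk_word u q) (walk_word u' q'))"
  using assms(1,3)
proof (induct w)
  case Nil
  have "word_cong ([] @ walk_word u q) (walk_word u q)" by simp
  then show ?case using assms(2) by (metis le_add1)
next
  case (Cons g w)
  have g: "g \<in> lpa_gens G" using Cons.prems by auto
  have "length w \<le> length q \<or> out_arcs G v = {}" using Cons.prems by auto
  with Cons consider "word_zero (w @ walk_word u q)" |
    u' q' where "awalk u' q' v" "length q \<le> length q' + length w" "word_cong (w @ walk_word u q) (walk_word u' q')"
    by auto
  then show ?case
  proof cases
    case 1
    then show ?thesis using word_zero_left[of "w @ walk_word u q" "[g]"] g by simp
  next
    case (2 u' q')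
    have c: "word_cong (g # w @ walk_word u q) (g # walk_word u' q')"
      using word_cong_left[OF 2(3), of "[g]"] g by simp
    have "word_zero (g # walk_word u' q') \<or>
      (\<exists>u'' q''. awalk u'' q'' v \<and> length q' \<le> length q'' + 1 \<and> word_cong (g # walk_word u' q') (walk_word u'' q''))"
    proof (cases g)
      case (Vertex x)
      then have "x \<in> verts G" using g by auto
      then show ?thesis
        using Vertex word_zero_vertex_walk[OF 2(1)] word_cong_vertex_walk[OF 2(1)] 2(1)
        by (metis trans_le_add1 order_refl)
    next
      case (Edge e)
      then have "e \<in> arcs G" using g by auto
      then show ?thesis
        using Edge word_zero_edge_walk[OF 2(1)] word_cong_edge_walk[OF 2(1)] 2(1)
        by (metis awalk_Cons_iff length_Cons le_SucI trans_le_add1 order_refl)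
    next
      case (Ghost e)
      then have e: "e \<in> arcs G" using g by auto
      show ?thesis
      proof (cases q')
        case Nil
        \<comment> \<open>The invariant now reads \<open>length q \<le> length w\<close>, which
          rules out the length alternative of the hypothesis.\<close>
        then have "out_arcs G v = {}" "u' = v" using 2 Cons.prems by (auto simp: awalk_Nil_iff)
        then have "tail G e \<noteq> u'" using e by auto
        then show ?thesis using word_zero_ghost_walk[OF 2(1) e] Ghost by simp
      next
        case (Cons f r)
        then have "awalk (head G f) r v" using 2(1) by (auto simp: awalk_Cons_iff)
        then show ?thesis
          using ghost_walk_Cons[of u' f r v e] 2(1) e Ghost Cons by fastforce
      qed
    qed
    then show ?thesis
      using word_cong_zero_iff[OF c] word_cong_trans[OF c] 2(2) by fastforce
  qed
qed

text \<open>The map \<open>h\<close> describes the reduction of single words, with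
  \<open>None\<close> standing for zero. Naming the reduced element through \<open>h\<close> keeps
  its coefficients accessible.\<close>

lemma linear_lift:
  assumes "\<And>w. w \<in> Poly_Mapping.keys p \<Longrightarrow>
    (case h w of None \<Rightarrow> word_zero (a @ w @ b) | Some w' \<Rightarrow> word_cong (a @ w @ b) w')"
  shows "mon a * p * mon b -
    (\<Sum>w\<in>Poly_Mapping.keys p. case h w of None \<Rightarrow> 0
       | Some w' \<Rightarrow> Poly_Mapping.single w' (Poly_Mapping.lookup p w)) \<in> J"
proof -
  have "mon a * p * mon b = (\<Sum>w\<in>Poly_Mapping.keys p. Poly_Mapping.single (a @ w @ b) (Poly_Mapping.lookup p w))"
    by (subst sum_monomials[of p]) (simp add: sum_distrib_left sum_distrib_right single_mult_single)
  moreover have "(\<Sum>w\<in>Poly_Mapping.keys p. Poly_Mapping.single (a @ w @ b) (Poly_Mapping.lookup p w) -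
    (case h w of None \<Rightarrow> 0 | Some w' \<Rightarrow> Poly_Mapping.single w' (Poly_Mapping.lookup p w))) \<in> J"
  proof (rule J_sum)
    fix w assume w: "w \<in> Poly_Mapping.keys p"
    show "Poly_Mapping.single (a @ w @ b) (Poly_Mapping.lookup p w) -
      (case h w of None \<Rightarrow> 0 | Some w' \<Rightarrow> Poly_Mapping.single w' (Poly_Mapping.lookup p w)) \<in> J"
    proof (cases "h w")
      case None
      then show ?thesis
        using assms[OF w] J_scal[of "mon (a @ w @ b)" "Poly_Mapping.lookup p w"]
        by (simp add: word_zero_def single_mult_single)
    next
      case (Some w')
      then show ?thesis
        using assms[OF w] J_scal[of "mon (a @ w @ b) - mon w'" "Poly_Mapping.lookup p w"]
        by (simp add: word_cong_def single_mult_single right_diff_distrib)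
    qed
  qed
  ultimately show ?thesis by (simp add: sum_subtractf)
qed

text \<open>Here \<open>h\<close> is obtained by choice, and only the support of the reduced element
  is recorded.\<close>

lemma linear_lift_ex:
  assumes "\<And>w. w \<in> Poly_Mapping.keys p \<Longrightarrow> word_zero (a @ w @ b) \<or> (\<exists>w'\<in>W. word_cong (a @ w @ b) w')"
  obtains p' where "Poly_Mapping.keys p' \<subseteq> W" "mon a * p * mon b - p' \<in> J"
proof -
  define h where "h w = (if word_zero (a @ w @ b) then None else Some (SOME w'. w' \<in> W \<and> word_cong (a @ w @ b) w'))" for w
  have h: "w' \<in> W \<and> word_cong (a @ w @ b) w'" if "w \<in> Poly_Mapping.keys p" "h w = Some w'" for w w'
    using assms[OF that(1)] that(2) someI_ex[of "\<lambda>w'. w' \<in> W \<and> word_cong (a @ w @ b) w'"]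
    by (auto simp: h_def split: if_splits)
  let ?p = "\<Sum>w\<in>Poly_Mapping.keys p. case h w of None \<Rightarrow> 0
       | Some w' \<Rightarrow> Poly_Mapping.single w' (Poly_Mapping.lookup p w)"
  have "mon a * p * mon b - ?p \<in> J"
  proof (rule linear_lift)
    fix w assume w: "w \<in> Poly_Mapping.keys p"
    have "word_zero (a @ w @ b)" if "h w = None"
      using that by (simp add: h_def split: if_splits)
    then show "case h w of None \<Rightarrow> word_zero (a @ w @ b) | Some w' \<Rightarrow> word_cong (a @ w @ b) w'"
      using h[OF w] by (cases "h w") auto
  qed
  moreover have "Poly_Mapping.keys ?p \<subseteq> W"
    by (rule order_trans[OF keys_sum_subset]) (use h in \<open>auto split: option.splits if_splits\<close>)
  ultimately show ?thesis using that by blast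
qed

end

section \<open>Closed walks\<close>

abbreviation list_power :: "'b list \<Rightarrow> nat \<Rightarrow> 'b list" where
  "list_power c n \<equiv> concat (replicate n c)"

lemma list_power_add: "list_power c (m + n) = list_power c m @ list_power c n"
  by (simp add: replicate_add)

lemma list_power_mult: "list_power (list_power c m) n = list_power c (m * n)"
  by (induct n) (simp_all add: list_power_add)

lemma length_list_power [simp]: "length (list_power c n) = n * length c"
  by (induct n) simp_all

lemma prefix_list_power: "m \<le> n \<Longrightarrow> prefix (list_power c m) (list_power c n)"
  by (auto simp: le_iff_add list_power_add simp del: replicate_add)

lemma prefix_comparable: "prefix p r \<Longrightarrow> prefix q r \<Longrightarrow> prefix p q \<or> prefix q p"
  using prefix_same_cases by blast

text \<open>Iterating the hypothesis shows that \<open>d\<close> is a prefix of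
  \<open>list_power a k @ d\<close> for every \<open>k\<close>. For \<open>k = length d\<close> the
  power alone is at least as long as \<open>d\<close>, since \<open>a\<close> is nonempty.\<close>

lemma prefix_shift_list_power:
  assumes "prefix d (a @ d)" "a \<noteq> []"
  shows "prefix d (list_power a (length d))"
proof -
  have "prefix d (list_power a k @ d)" for k
  proof (induct k)
    case (Suc k)
    then have "prefix (a @ d) (a @ list_power a k @ d)" by simp
    with assms(1) show ?case using prefix_order.trans by fastforce
  qed simp
  from this[of "length d"] have "prefix d (list_power a (length d) @ d)" .
  moreover have "length d \<le> length (list_power a (length d))"
    using assms(2) by (cases a) auto
  ultimately show ?thesis
    using prefix_length_prefix[of d "list_power a (length d) @ d" "list_power a (length d)"] by auto
qed

context wf_digraph
begin

lemma awalk_last_unique: "awalk u p v \<Longrightarrow> awalk u p w \<Longrightarrow> v = w"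
  using awalk_ends[of u p v u w] by auto

lemma awalk_drop_cycle: "awalk v c v \<Longrightarrow> awalk v (c @ d) w \<Longrightarrow> awalk v d w"
  by (erule awalk_splitE) (use awalk_last_unique in blast)

lemma awalk_list_power:
  assumes "awalk v c v"
  shows "awalk v (list_power c n) v"
proof (induct n)
  case 0
  show ?case using awalk_hd_in_verts[OF assms] by (simp add: awalk_Nil_iff)
next
  case (Suc n)
  from awalk_appendI[OF assms Suc] show ?case by (simp del: awalk_append_iff)
qed

text \<open>A shortest nonempty closed walk does not return to \<open>v\<close> before its end,
  which makes its powers recognisable. At a vertex without such walks the value is
  arbitrary.\<close>

definition min_cycle :: "'a \<Rightarrow> 'b list" where
  "min_cycle v = arg_min length (\<lambda>c. awalk v c v \<and> c \<noteq> [])"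

lemma
  assumes "awalk v c v" "c \<noteq> []"
  shows awalk_min_cycle: "awalk v (min_cycle v) v"
    and min_cycle_not_Nil: "min_cycle v \<noteq> []"
    and min_cycle_le: "length (min_cycle v) \<le> length c"
proof -
  let ?P = "\<lambda>c. awalk v c v \<and> c \<noteq> []"
  have "?P c" using assms by simp
  from arg_min_nat_lemma[of ?P, OF this, of length]
  show "awalk v (min_cycle v) v" "min_cycle v \<noteq> []" "length (min_cycle v) \<le> length c"
    using assms unfolding min_cycle_def by blast+
qed

text \<open>By minimality a nonempty \<open>d\<close> is at least as long as the cycle, so it starts
  with a full copy of it; removing this copy leaves a closed walk to which the induction
  applies.\<close>

lemma closed_prefix_min_cycle_power:
  assumes "awalk v d v" "prefix d (list_power (min_cycle v) n)"
  shows "\<exists>j. d = list_power (min_cycle v) j"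
  using assms
proof (induct n arbitrary: d)
  case 0
  then have "d = list_power (min_cycle v) 0" by simp
  then show ?case by blast
next
  case (Suc n)
  let ?c = "min_cycle v"
  show ?case
  proof (cases "d = []")
    case True
    then have "d = list_power ?c 0" by simp
    then show ?thesis by blast
  next
    case False
    then have c: "awalk v ?c v" "length ?c \<le> length d"
      using awalk_min_cycle min_cycle_le Suc.prems(1) by blast+
    have "prefix ?c d"
      by (rule prefix_length_prefix[OF _ Suc.prems(2) c(2)]) simp
    then obtain d' where d': "d = ?c @ d'" by (auto simp: prefix_def)
    have "awalk v d' v"
      by (rule awalk_drop_cycle[OF c(1)]) (use Suc.prems(1) d' in simp)
    moreover have "prefix d' (list_power ?c n)"
      using Suc.prems(2) d' by simp
    ultimately obtain j where "d' = list_power ?c j" using Suc.hyps by blast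
    then have "d = list_power ?c (Suc j)" by (simp add: d')
    then show ?thesis by blast
  qed
qed

text \<open>If the prefix relation held, \<open>q\<close> would be a prefix of the power and hence a
  power of the cycle itself. Commuting it past the \<open>n\<close> copies leaves \<open>d\<close>
  as a prefix of \<open>q @ d\<close>, hence of a power of the cycle. The bound
  \<open>length q \<le> n\<close> ensures that \<open>n\<close> copies of the cycle cover
  \<open>q\<close>.\<close>

lemma not_prefix_cycle_shift:
  assumes d: "\<And>m. \<not> prefix d (list_power (min_cycle v) m)"
    and q: "awalk v q v" "q \<noteq> []" "length q \<le> n"
  shows "\<not> prefix (list_power (min_cycle v) n @ d) (q @ list_power (min_cycle v) n @ d)"
proof
  let ?c = "min_cycle v"
  assume pre: "prefix (list_power ?c n @ d) (q @ list_power ?c n @ d)"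
  have c: "awalk v ?c v" "?c \<noteq> []"
    using awalk_min_cycle min_cycle_not_Nil q by blast+
  have "length q \<le> length (list_power ?c n)"
    using q(3) c(2) by (cases ?c) (auto intro: order_trans)
  moreover have "prefix (list_power ?c n) (q @ list_power ?c n @ d)"
    by (rule append_prefixD[OF pre])
  ultimately have "prefix q (list_power ?c n)"
    using prefix_length_prefix[of q "q @ list_power ?c n @ d"] by simp
  from closed_prefix_min_cycle_power[OF q(1) this] obtain j where j: "q = list_power ?c j" by blast
  have "q @ list_power ?c n = list_power ?c n @ q"
    unfolding j list_power_add[symmetric] by (simp only: add.commute)
  then have "prefix (list_power ?c n @ d) (list_power ?c n @ q @ d)"
    using pre by (metis append.assoc)
  then have "prefix d (q @ d)" by simp
  from prefix_shift_list_power[OF this q(2)] d[of "j * length d"] show False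
    by (simp add: j list_power_mult)
qed

text \<open>\<open>v\<close> lies on a cycle which has no exit in the quotient graph \<open>E/H\<close>.\<close>

definition no_exit :: "'a set \<Rightarrow> 'a \<Rightarrow> bool" where
  "no_exit H v \<longleftrightarrow> v \<in> verts G - H \<and> (\<exists>c. awalk v c v \<and> c \<noteq> []) \<and>
    (\<forall>p q x y. awalk v p x \<and> awalk v q y \<and> x \<notin> H \<and> y \<notin> H \<longrightarrow> prefix p q \<or> prefix q p)"

lemma no_exit_comparable:
  "no_exit H v \<Longrightarrow> awalk v p x \<Longrightarrow> awalk v q y \<Longrightarrow> x \<notin> H \<Longrightarrow> y \<notin> H \<Longrightarrow> prefix p q \<or> prefix q p"
  unfolding no_exit_def by blast

text \<open>Both concatenations are closed walks of the same length, so comparability forces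
  equality.\<close>

lemma no_exit_commute:
  assumes "no_exit H v" "awalk v c v" "awalk v d v"
  shows "c @ d = d @ c"
proof -
  have "v \<notin> H" using assms(1) by (simp add: no_exit_def)
  then have "prefix (c @ d) (d @ c) \<or> prefix (d @ c) (c @ d)"
    by (intro no_exit_comparable[OF assms(1)] awalk_appendI) (use assms in auto)
  then show ?thesis by (metis prefix_length_prefix prefix_order.antisym length_append add.commute order_refl prefix_order.refl)
qed

text \<open>The exponent \<open>length q\<close> only serves to make the power at least as long as
  \<open>q\<close>; comparability does the rest.\<close>

lemma no_exit_prefix_power:
  assumes "no_exit H v" "awalk v q x" "x \<notin> H"
  shows "prefix q (list_power (min_cycle v) (length q))"
proof -
  let ?c = "min_cycle v"
  have c: "awalk v ?c v" "?c \<noteq> []" and v: "v \<notin> H"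
    using assms(1) awalk_min_cycle min_cycle_not_Nil unfolding no_exit_def by blast+
  have "length q \<le> length (list_power ?c (length q))"
    using c(2) by (cases ?c) auto
  moreover have "prefix q (list_power ?c (length q)) \<or> prefix (list_power ?c (length q)) q"
    using no_exit_comparable[OF assms(1,2) awalk_list_power[OF c(1)] assms(3) v] by simp
  ultimately show ?thesis
    using prefix_length_prefix[OF prefix_order.refl] by blast
qed

lemma no_exit_closed_power:
  assumes "no_exit H v" "awalk v q v"
  shows "\<exists>j. q = list_power (min_cycle v) j"
  using closed_prefix_min_cycle_power[OF assms(2) no_exit_prefix_power[OF assms]] assms(1)
  by (auto simp: no_exit_def)

text \<open>The remainder of a power of the cycle that has \<open>q\<close> as a prefix leads back
  to \<open>v\<close>.\<close>

lemma no_exit_return: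
  assumes "no_exit H v" "awalk v q x" "x \<notin> H"
  shows "\<exists>q'. awalk x q' v"
proof -
  obtain r where "list_power (min_cycle v) (length q) = q @ r"
    using no_exit_prefix_power[OF assms] by (auto simp: prefix_def)
  moreover have "awalk v (list_power (min_cycle v) (length q)) v"
    using assms(1) awalk_min_cycle by (intro awalk_list_power) (auto simp: no_exit_def)
  ultimately have "awalk v (q @ r) v" by simp
  then show ?thesis using awalk_last_unique[OF assms(2)] by (metis awalk_splitE)
qed

text \<open>Prefixes of powers of one cycle are pairwise comparable, so of two incomparable walks at
  least one is not such a prefix.\<close>

lemma exit_walk:
  assumes "v \<in> verts G" "v \<notin> H" "awalk v c v" "c \<noteq> []" "\<not> no_exit H v"
  obtains d r where "awalk v d r" "r \<notin> H" "\<And>m. \<not> prefix d (list_power (min_cycle v) m)"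
proof -
  obtain p q x y where pq: "awalk v p x" "awalk v q y" "x \<notin> H" "y \<notin> H" "\<not> prefix p q" "\<not> prefix q p"
    using assms unfolding no_exit_def by blast
  have "\<not> (prefix p (list_power (min_cycle v) m) \<and> prefix q (list_power (min_cycle v) n))" for m n
  proof
    assume "prefix p (list_power (min_cycle v) m) \<and> prefix q (list_power (min_cycle v) n)"
    then have "prefix p (list_power (min_cycle v) (max m n))" "prefix q (list_power (min_cycle v) (max m n))"
      using prefix_list_power[of m "max m n" "min_cycle v"] prefix_list_power[of n "max m n" "min_cycle v"]
        prefix_order.trans by force+
    then show False using prefix_comparable pq(5,6) by blast
  qed
  then consider "\<And>m. \<not> prefix p (list_power (min_cycle v) m)" | "\<And>m. \<not> prefix q (list_power (min_cycle v) m)"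
    by blast
  then show ?thesis using pq that by cases blast+
qed

end

section \<open>Reduction to closed walks\<close>

lemma ex_key: "p \<noteq> 0 \<Longrightarrow> \<exists>w. w \<in> Poly_Mapping.keys p"
  using poly_mapping_eqI[of p 0] by (auto simp: in_keys_iff)

context lpa_preideal
begin

lemma J_mult_left: "x \<in> J \<Longrightarrow> a \<in> carrier (free_lpa K G) \<Longrightarrow> a * x \<in> J"
  by (rule free_idealD(7)[OF ideal])

lemma J_mult_right: "x \<in> J \<Longrightarrow> a \<in> carrier (free_lpa K G) \<Longrightarrow> x * a \<in> J"
  by (rule free_idealD(8)[OF ideal])

lemma linear_lift_id:
  assumes "\<And>w. w \<in> Poly_Mapping.keys p \<Longrightarrow> word_cong (a @ w @ b) w"
  shows "mon a * p * mon b - p \<in> J"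
  using linear_lift[where p = p and h = Some and a = a and b = b] assms by (simp flip: sum_monomials)

text \<open>The words of \<open>p\<close> are sorted by \<open>g\<close>, and the factors
  \<open>a x\<close> and \<open>b x\<close> cut out the class of \<open>x\<close> modulo
  \<open>J\<close>. It is applied with vertices as factors, to separate words by their source or by
  their right end.\<close>

lemma partition_mem:
  assumes "\<And>x. x \<in> g ` Poly_Mapping.keys p \<Longrightarrow> mon (a x) * p * mon (b x) \<in> J"
    and "\<And>x w. x \<in> g ` Poly_Mapping.keys p \<Longrightarrow> w \<in> Poly_Mapping.keys p \<Longrightarrow>
      (if g w = x then word_cong (a x @ w @ b x) w else word_zero (a x @ w @ b x))"
  shows "p \<in> J"
proof -
  let ?K = "Poly_Mapping.keys p"
  let ?s = "\<lambda>w. Poly_Mapping.single w (Poly_Mapping.lookup p w)"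
  have "(\<Sum>w\<in>{w\<in>?K. g w = x}. ?s w) \<in> J" if x: "x \<in> g ` ?K" for x
  proof -
    let ?h = "\<lambda>w. if g w = x then Some w else None"
    have "mon (a x) * p * mon (b x) - (\<Sum>w\<in>?K. case ?h w of None \<Rightarrow> 0
       | Some w' \<Rightarrow> Poly_Mapping.single w' (Poly_Mapping.lookup p w)) \<in> J"
    proof (rule linear_lift)
      fix w assume "w \<in> ?K"
      from assms(2)[OF x this]
      show "case ?h w of None \<Rightarrow> word_zero (a x @ w @ b x) | Some w' \<Rightarrow> word_cong (a x @ w @ b x) w'"
        by (cases "g w = x") simp_all
    qed
    moreover have "(\<Sum>w\<in>?K. case ?h w of None \<Rightarrow> 0
       | Some w' \<Rightarrow> Poly_Mapping.single w' (Poly_Mapping.lookup p w)) = (\<Sum>w\<in>{w\<in>?K. g w = x}. ?s w)"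
      by (subst sum.inter_filter) (simp, rule sum.cong, simp_all)
    ultimately show ?thesis using assms(1)[OF x] J_mem_cong by simp
  qed
  then have "(\<Sum>x\<in>g ` ?K. \<Sum>w\<in>{w\<in>?K. g w = x}. ?s w) \<in> J" by (rule J_sum)
  also have "(\<Sum>x\<in>g ` ?K. \<Sum>w\<in>{w\<in>?K. g w = x}. ?s w) = (\<Sum>w\<in>?K. ?s w)"
    by (rule sum.group) auto
  also have "\<dots> = p" by (rule sum_monomials[symmetric])
  finally show ?thesis .
qed

lemma word_zero_walk: "word_zero [Vertex u] \<Longrightarrow> awalk u q v \<Longrightarrow> word_zero (walk_word u q)"
  using word_zero_right[of "[Vertex u]" "map Edge q"] set_map_Edge[of u q v] by (simp add: walk_word_def)

text \<open>The summation relation gives \<open>u p = \<Sum> e (e^* p)\<close>.\<close>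

lemma regular_mem_left:
  assumes "regular_vertex G u" "p \<in> carrier (free_lpa K G)"
    "\<And>e. e \<in> out_arcs G u \<Longrightarrow> mon [Ghost e] * p \<in> J"
  shows "mon [Vertex u] * p \<in> J"
proof -
  have "mon [Edge e] * (mon [Ghost e] * p) \<in> J" if "e \<in> out_arcs G u" for e
    by (rule J_mon_left[OF assms(3)[OF that]]) (use that in auto)
  then have "(\<Sum>e\<in>out_arcs G u. mon [Edge e] * (mon [Ghost e] * p)) \<in> J"
    by (rule J_sum)
  then have "(\<Sum>e\<in>out_arcs G u. mon [Edge e, Ghost e]) * p \<in> J"
    by (simp add: sum_distrib_right single_mult_single flip: mult.assoc)
  then show ?thesis
    using J_mult_right[OF regular_vertex_relator[OF assms(1)] assms(2)] J_mem_cong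
    by (simp add: left_diff_distrib)
qed

text \<open>The summation relation on the other side: \<open>p u = \<Sum> (p e) e^*\<close>.\<close>

lemma regular_mem_right:
  assumes "regular_vertex G u" "p \<in> carrier (free_lpa K G)"
    "\<And>e. e \<in> out_arcs G u \<Longrightarrow> p * mon [Edge e] \<in> J"
  shows "p * mon [Vertex u] \<in> J"
proof -
  have "p * mon [Edge e] * mon [Ghost e] \<in> J" if "e \<in> out_arcs G u" for e
    by (rule J_mon_right[OF assms(3)[OF that]]) (use that in auto)
  then have "(\<Sum>e\<in>out_arcs G u. p * mon [Edge e] * mon [Ghost e]) \<in> J"
    by (rule J_sum)
  then have "p * (\<Sum>e\<in>out_arcs G u. mon [Edge e, Ghost e]) \<in> J"
    by (simp add: sum_distrib_left single_mult_single mult.assoc)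
  then show ?thesis
    using J_mult_left[OF regular_vertex_relator[OF assms(1)] assms(2)] J_mem_cong
    by (simp add: right_diff_distrib)
qed

text \<open>This vertex acts as a right identity on the letter; every other vertex annihilates it
  from the right.\<close>

fun letter_target :: "('a, 'b) lpa_gen \<Rightarrow> 'a" where
  "letter_target (Vertex v) = v"
| "letter_target (Edge e) = head G e"
| "letter_target (Ghost e) = tail G e"

lemma word_target:
  assumes "w \<noteq> []" "set w \<subseteq> lpa_gens G" "x \<in> verts G"
  shows "if letter_target (last w) = x then word_cong (w @ [Vertex x]) w else word_zero (w @ [Vertex x])"
proof -
  obtain w' g where w: "w = w' @ [g]" using assms(1) by (cases w rule: rev_cases) auto
  let ?v = "letter_target g"
  have g: "g \<in> lpa_gens G" "set w' \<subseteq> lpa_gens G" using assms w by auto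
  then have v: "?v \<in> verts G" and "word_cong [g, Vertex ?v] [g]"
    using word_cong_vertex_vertex word_cong_edge_head word_cong_ghost_tail by (cases g; auto)+
  then have 1: "word_cong (w @ [Vertex ?v]) w"
    using word_cong_left[of "[g, Vertex ?v]" "[g]" w'] g w by simp
  show ?thesis
  proof (cases "?v = x")
    case True
    then show ?thesis using 1 w by simp
  next
    case False
    then have "word_zero (w @ [Vertex ?v, Vertex x])"
      using word_zero_left[OF word_zero_vertex_vertex[OF v assms(3)], of w] assms by simp
    moreover have "word_cong ((w @ [Vertex ?v]) @ [Vertex x]) (w @ [Vertex x])"
      using word_cong_right[OF 1, of "[Vertex x]"] assms by simp
    ultimately show ?thesis using False word_cong_zero_iff w by auto
  qed
qed

end

section \<open>Descent for a pair of ideals \<open>J \<subseteq> J'\<close>\<close>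

locale lpa_preideal_ext = lpa_preideal G K J
  for G :: "('a, 'b) pre_digraph" and K :: "'k::field itself" and J +
  fixes J' :: "('k, 'a, 'b) free_elem set"
  assumes ideal': "two_sided_ideal (free_lpa K G) J'" and sub: "J \<subseteq> J'"
    and row_finite: "row_finite G"
begin

lemma J'_carrier: "p \<in> J' \<Longrightarrow> p \<in> carrier (free_lpa K G)"
  using free_idealD(1)[OF ideal'] by blast

lemma J'_mem_cong: "x - y \<in> J \<Longrightarrow> x \<in> J' \<longleftrightarrow> y \<in> J'"
  using free_idealD(3)[OF ideal', of "x - y" y] free_idealD(6)[OF ideal', of x "x - y"] sub by auto

lemma J'_mon_mult: "p \<in> J' \<Longrightarrow> set a \<subseteq> lpa_gens G \<Longrightarrow> set b \<subseteq> lpa_gens G \<Longrightarrow> mon a * p * mon b \<in> J'"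
  by (intro free_idealD(9,10)[OF ideal'])

lemma regular_if_out_arc: "e \<in> arcs G \<Longrightarrow> regular_vertex G (tail G e)"
  using row_finite unfolding row_finite_def regular_vertex_def by (auto simp: out_arcs_def)

text \<open>Induction on the length bound. If the trivial walk occurs in \<open>p\<close>, then
  \<open>u = v\<close> and \<open>V\<close> applies. Otherwise every word starts with an edge, each
  \<open>e^* p\<close> consists of shorter walks and lies in \<open>J\<close> by induction, and the
  summation relation at \<open>u\<close> recovers \<open>p\<close>.\<close>

lemma strip_left:
  assumes V: "\<And>v p. p \<in> J' \<Longrightarrow> Poly_Mapping.keys p \<subseteq> {walk_word v q | q. awalk v q v} \<Longrightarrow>
      walk_word v [] \<in> Poly_Mapping.keys p \<Longrightarrow> p \<in> J"
    and "p \<in> J'" "Poly_Mapping.keys p \<subseteq> {walk_word u q | q. awalk u q v \<and> length q \<le> n}"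
  shows "p \<in> J"
  using assms(2,3)
proof (induct n arbitrary: u p)
  case 0
  show ?case
  proof (cases "p = 0")
    case False
    then have "walk_word u [] \<in> Poly_Mapping.keys p" using 0(2) ex_key[of p] by auto
    moreover from this have "u = v" using 0 by (auto simp: awalk_Nil_iff)
    ultimately show ?thesis using V[OF 0(1)] 0(2) by auto
  qed (simp add: J_zero)
next
  case (Suc n)
  consider "walk_word u [] \<in> Poly_Mapping.keys p" | "p = 0" |
    "p \<noteq> 0" "walk_word u [] \<notin> Poly_Mapping.keys p" by blast
  then show ?case
  proof cases
    case 1
    then have "u = v" using Suc.prems by (auto simp: awalk_Nil_iff)
    then show ?thesis using V[OF Suc.prems(1)] 1 Suc.prems(2) by auto
  next
    case 2
    then show ?thesis by (simp add: J_zero)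
  next
    case 3
    have key: "\<exists>f q. w = walk_word u (f # q) \<and> awalk u (f # q) v \<and> length q \<le> n"
      if w: "w \<in> Poly_Mapping.keys p" for w
    proof -
      obtain q where q: "w = walk_word u q" "awalk u q v" "length q \<le> Suc n"
        using Suc.prems(2) w by auto
      then show ?thesis using 3(2) w by (cases q) auto
    qed
    obtain w where "w \<in> Poly_Mapping.keys p" using ex_key[OF 3(1)] by blast
    from key[OF this] have reg: "regular_vertex G u"
      using regular_if_out_arc by (auto simp: awalk_Cons_iff)
    have "mon [Ghost e] * p \<in> J" if e: "e \<in> out_arcs G u" for e
    proof -
      let ?W = "{walk_word (head G e) q | q. awalk (head G e) q v \<and> length q \<le> n}"
      have e': "e \<in> arcs G" using e by simp
      have "word_zero ([Ghost e] @ w @ []) \<or> (\<exists>w'\<in>?W. word_cong ([Ghost e] @ w @ []) w')"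
        if w: "w \<in> Poly_Mapping.keys p" for w
      proof -
        obtain f q where q: "w = walk_word u (f # q)" "awalk u (f # q) v" "length q \<le> n"
          using key[OF w] by blast
        show ?thesis
        proof (cases "e = f")
          case True
          then have "walk_word (head G e) q \<in> ?W" using q by (auto simp: awalk_Cons_iff)
          then show ?thesis using ghost_walk_Cons(1)[OF q(2) e' True] q(1) True by auto
        next
          case False
          then show ?thesis using ghost_walk_Cons(2)[OF q(2) e' False] q(1) by simp
        qed
      qed
      then obtain p' where p': "Poly_Mapping.keys p' \<subseteq> ?W" "mon [Ghost e] * p * mon [] - p' \<in> J"
        by (rule linear_lift_ex[of p "[Ghost e]" "[]" ?W])
      moreover have "mon [Ghost e] * p * mon [] \<in> J'"
        by (rule J'_mon_mult) (use Suc.prems(1) e' in auto)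
      ultimately have "p' \<in> J'" using J'_mem_cong by blast
      then have "p' \<in> J" using p'(1) by (rule Suc.hyps)
      then show ?thesis using p'(2) J_mem_cong by simp
    qed
    then have "mon [Vertex u] * p \<in> J"
      by (rule regular_mem_left[OF reg J'_carrier[OF Suc.prems(1)]])
    moreover have "mon [Vertex u] * p * mon [] - p \<in> J"
    proof (rule linear_lift_id)
      fix w assume "w \<in> Poly_Mapping.keys p"
      from key[OF this] obtain q where "w = walk_word u q" "awalk u q v" by blast
      then show "word_cong ([Vertex u] @ w @ []) w" using word_cong_vertex_walk by simp
    qed
    ultimately show ?thesis using J_mem_cong by simp
  qed
qed

text \<open>Induction on \<open>n\<close>. At a sink the trivial walk is already admissible.
  Elsewhere the summation relation reduces \<open>y x\<close> to the elements \<open>y e\<close>,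
  and a walk from the head of \<open>e\<close> becomes one edge longer when preceded by
  \<open>e\<close>.\<close>

lemma strip_right:
  assumes "x \<in> verts G" "y \<in> carrier (free_lpa K G)"
    "\<And>q v. awalk x q v \<Longrightarrow> n \<le> length q \<or> out_arcs G v = {} \<Longrightarrow> y * mon (walk_word x q) \<in> J"
  shows "y * mon [Vertex x] \<in> J"
  using assms
proof (induct n arbitrary: x y)
  case 0
  from 0(3)[of "[]" x] 0(1) show ?case by (simp add: awalk_Nil_iff walk_word_def)
next
  case (Suc n)
  show ?case
  proof (cases "out_arcs G x = {}")
    case True
    from Suc.prems(3)[of "[]" x] Suc.prems(1) True show ?thesis by (simp add: awalk_Nil_iff walk_word_def)
  next
    case False
    then have reg: "regular_vertex G x" using regular_if_out_arc by auto
    then show ?thesis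
    proof (rule regular_mem_right[OF _ Suc.prems(2)])
      fix e assume e: "e \<in> out_arcs G x"
      have 1: "y * (mon w - mon w') \<in> J" if "word_cong w w'" for w w'
        using that Suc.prems(2) by (auto simp: word_cong_def intro: J_mult_left)
      have "y * mon [Edge e] * mon [Vertex (head G e)] \<in> J"
      proof (rule Suc.hyps)
        show "y * mon [Edge e] \<in> carrier (free_lpa K G)"
          using Suc.prems(2) e by (intro carrier_free_lpa_mult carrier_free_lpa_mon) auto
        fix q v assume q: "awalk (head G e) q v" "n \<le> length q \<or> out_arcs G v = {}"
        have "awalk x (e # q) v" using q e by (auto simp: awalk_Cons_iff)
        then have "y * mon (walk_word x (e # q)) \<in> J"
          by (rule Suc.prems(3)) (use q(2) in auto)
        moreover have "y * (mon (Edge e # walk_word (head G e) q) - mon (walk_word x (e # q))) \<in> J"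
          using 1 word_cong_edge_walk[OF q(1), of e] e by auto
        ultimately have "y * mon (Edge e # walk_word (head G e) q) \<in> J"
          using J_mem_cong by (simp add: right_diff_distrib)
        then show "y * mon [Edge e] * mon (walk_word (head G e) q) \<in> J"
          by (simp add: mult.assoc single_mult_single)
      qed (use e in auto)
      then have "y * mon [Edge e, Vertex (head G e)] \<in> J"
        by (simp add: mult.assoc single_mult_single)
      moreover have "y * (mon [Edge e, Vertex (head G e)] - mon [Edge e]) \<in> J"
        using 1 word_cong_edge_head e by auto
      ultimately show "y * mon [Edge e] \<in> J"
        using J_mem_cong by (simp add: right_diff_distrib)
    qed
  qed
qed

text \<open>Left multiplication by vertices separates the sources, and \<open>strip_left\<close>
  then deals with each source.\<close>

lemma walk_comb_mem:
  assumes V: "\<And>v p. p \<in> J' \<Longrightarrow> Poly_Mapping.keys p \<subseteq> {walk_word v q | q. awalk v q v} \<Longrightarrow>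
      walk_word v [] \<in> Poly_Mapping.keys p \<Longrightarrow> p \<in> J"
    and p: "p \<in> J'" "Poly_Mapping.keys p \<subseteq> {walk_word u q | u q. awalk u q v}"
  shows "p \<in> J"
proof -
  define src where "src w = (THE u. hd w = Vertex u)" for w :: "('a, 'b) lpa_gen list"
  have src [simp]: "src (walk_word u q) = u" for u q
    by (simp add: src_def walk_word_def)
  have key: "\<exists>u q. w = walk_word u q \<and> awalk u q v \<and> u \<in> verts G" if "w \<in> Poly_Mapping.keys p" for w
    using that p(2) awalk_hd_in_verts by blast
  show ?thesis
  proof (rule partition_mem[where g = src and a = "\<lambda>u. [Vertex u]" and b = "\<lambda>_. []"])
    fix u assume "u \<in> src ` Poly_Mapping.keys p"
    then have u: "u \<in> verts G" using key by fastforce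
    define n where "n = Max (length ` Poly_Mapping.keys p)"
    have n: "length w \<le> n" if "w \<in> Poly_Mapping.keys p" for w
      using that by (auto simp: n_def)
    let ?W = "{walk_word u q | q. awalk u q v \<and> length q \<le> n}"
    have "word_zero ([Vertex u] @ w @ []) \<or> (\<exists>w'\<in>?W. word_cong ([Vertex u] @ w @ []) w')"
      if w: "w \<in> Poly_Mapping.keys p" for w
    proof -
      obtain u' q where q: "w = walk_word u' q" "awalk u' q v" using p(2) w by auto
      show ?thesis
      proof (cases "u' = u")
        case True
        have "length q \<le> n" using n[OF w] q(1) by (simp add: walk_word_def)
        then have "w \<in> ?W" using q True by auto
        then show ?thesis using word_cong_vertex_walk[OF q(2)] q(1) True by auto
      next
        case False
        then show ?thesis using word_zero_vertex_walk[OF q(2) u] q(1) by simp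
      qed
    qed
    then obtain p' where p': "Poly_Mapping.keys p' \<subseteq> ?W" "mon [Vertex u] * p * mon [] - p' \<in> J"
      by (rule linear_lift_ex[of p "[Vertex u]" "[]" ?W])
    moreover have "mon [Vertex u] * p * mon [] \<in> J'"
      by (rule J'_mon_mult) (use p(1) u in auto)
    ultimately have "p' \<in> J'" using J'_mem_cong by blast
    then have "p' \<in> J" using p'(1) by (rule strip_left[rotated]) (rule V)
    then show "mon [Vertex u] * p * mon [] \<in> J" using p'(2) J_mem_cong by simp
  next
    fix u w assume "u \<in> src ` Poly_Mapping.keys p" and w: "w \<in> Poly_Mapping.keys p"
    then have "u \<in> verts G" using key by fastforce
    moreover obtain u' q where "w = walk_word u' q" "awalk u' q v"
      using key[OF w] by blast
    ultimately show "if src w = u then word_cong ([Vertex u] @ w @ []) w else word_zero ([Vertex u] @ w @ [])"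
      using word_cong_vertex_walk word_zero_vertex_walk by auto
  qed
qed

text \<open>Right multiplication by vertices separates the right ends of the words. For each of them
  \<open>strip_right\<close> permits multiplication by walks that are long or end in a sink, and by
  \<open>word_walk\<close> these turn \<open>y\<close> into a combination of walks with a common
  end.\<close>

theorem reduction_to_closed_walks:
  assumes V: "\<And>v p. p \<in> J' \<Longrightarrow> Poly_Mapping.keys p \<subseteq> {walk_word v q | q. awalk v q v} \<Longrightarrow>
      walk_word v [] \<in> Poly_Mapping.keys p \<Longrightarrow> p \<in> J"
  shows "J' \<subseteq> J"
proof
  fix y assume y: "y \<in> J'"
  have yc: "w \<noteq> [] \<and> set w \<subseteq> lpa_gens G" if "w \<in> Poly_Mapping.keys y" for w
    using J'_carrier[OF y] that by (simp add: carrier_free_lpa)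
  have lt: "letter_target (last w) \<in> verts G" if "w \<in> Poly_Mapping.keys y" for w
  proof -
    have "last w \<in> lpa_gens G" using yc[OF that] by auto
    then show ?thesis by (cases "last w") auto
  qed
  show "y \<in> J"
  proof (rule partition_mem[where g = "\<lambda>w. letter_target (last w)" and a = "\<lambda>_. []" and b = "\<lambda>u. [Vertex u]"])
    fix x assume "x \<in> (\<lambda>w. letter_target (last w)) ` Poly_Mapping.keys y"
    then have x: "x \<in> verts G" using lt by auto
    define n where "n = Max (length ` Poly_Mapping.keys y)"
    have n: "length w \<le> n" if "w \<in> Poly_Mapping.keys y" for w
      using that by (auto simp: n_def)
    have "y * mon [Vertex x] \<in> J"
    proof (rule strip_right[OF x J'_carrier[OF y]])
      fix q v assume q: "awalk x q v" "n \<le> length q \<or> out_arcs G v = {}"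
      let ?W = "{walk_word u q | u q. awalk u q v}"
      have "word_zero ([] @ w @ walk_word x q) \<or> (\<exists>w'\<in>?W. word_cong ([] @ w @ walk_word x q) w')"
        if w: "w \<in> Poly_Mapping.keys y" for w
      proof -
        have "length w \<le> length q \<or> out_arcs G v = {}" using n[OF w] q(2) by auto
        from word_walk[OF _ q(1) this] yc[OF w] show ?thesis by auto
      qed
      then obtain p where p: "Poly_Mapping.keys p \<subseteq> ?W" "mon [] * y * mon (walk_word x q) - p \<in> J"
        by (rule linear_lift_ex[of y "[]" "walk_word x q" ?W])
      moreover have "mon [] * y * mon (walk_word x q) \<in> J'"
        by (rule J'_mon_mult) (use y set_walk_word[OF q(1)] in auto)
      ultimately have "p \<in> J'" using J'_mem_cong by blast
      then have "p \<in> J" using p(1) by (rule walk_comb_mem[rotated]) (rule V)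
      then show "y * mon (walk_word x q) \<in> J" using p(2) J_mem_cong by simp
    qed
    then show "mon [] * y * mon [Vertex x] \<in> J" by simp
  next
    fix x w assume "x \<in> (\<lambda>w. letter_target (last w)) ` Poly_Mapping.keys y" "w \<in> Poly_Mapping.keys y"
    then show "if letter_target (last w) = x then word_cong ([] @ w @ [Vertex x]) w else word_zero ([] @ w @ [Vertex x])"
      using word_target[of w x] yc lt by auto
  qed
qed

end

section \<open>The vertices contained in an ideal\<close>

definition vertices_in :: "('a, 'b) pre_digraph \<Rightarrow> ('k::field, 'a, 'b) free_elem set \<Rightarrow> 'a set" where
  "vertices_in G J = {v \<in> verts G. mon [Vertex v] \<in> J}"

lemma (in lpa_preideal) vertices_in_word_zero: "v \<in> vertices_in G J \<longleftrightarrow> v \<in> verts G \<and> word_zero [Vertex v]"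
  by (simp add: vertices_in_def word_zero_def)

text \<open>For a walk \<open>q\<close> from \<open>u\<close> to \<open>v\<close>,
  \<open>v = q^* u q\<close> modulo the relators.\<close>

lemma (in lpa_preideal) hereditary_vertices_in: "hereditary G (vertices_in G J)"
  unfolding hereditary_def vertex_ge_def
proof (intro conjI ballI allI impI)
  fix u v assume u: "u \<in> vertices_in G J" and "\<exists>q. awalk u q v"
  then obtain q where q: "awalk u q v" by blast
  then have v: "awalk v [] v" using awalk_last_in_verts by (simp add: awalk_Nil_iff)
  have "word_zero (walk_word u q)" using word_zero_walk[OF _ q] u by (simp add: vertices_in_word_zero)
  then have "word_zero (ghost_word q @ walk_word u q)" using word_zero_left set_ghost_word[OF q] by blast
  moreover have "word_cong (ghost_word q @ walk_word u q) [Vertex v]"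
    using word_cong_ghost_word[OF q v] by (simp add: walk_word_def)
  ultimately show "v \<in> vertices_in G J" using word_cong_zero_iff v by (auto simp: vertices_in_word_zero awalk_Nil_iff)
qed (auto simp: vertices_in_def)

text \<open>A regular vertex is the sum of the elements \<open>e r(e) e^*\<close>.\<close>

lemma (in lpa_preideal) saturated_vertices_in: "saturated G (vertices_in G J)"
  unfolding saturated_def
proof (intro conjI allI impI)
  fix v assume v: "regular_vertex G v \<and> head G ` out_arcs G v \<subseteq> vertices_in G J"
  have "mon [Edge e, Ghost e] \<in> J" if e: "e \<in> out_arcs G v" for e
  proof -
    have "head G e \<in> vertices_in G J" using v e by blast
    then have "word_zero [Vertex (head G e)]" by (simp add: vertices_in_word_zero)
    then have "word_zero [Edge e, Vertex (head G e), Ghost e]"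
      using word_zero_ctx[of "[Vertex (head G e)]" "[Edge e]" "[Ghost e]"] e by simp
    then show ?thesis
      using word_cong_zero_iff[OF word_cong_right[OF word_cong_edge_head, of e "[Ghost e]"]] e by (simp add: word_zero_def)
  qed
  then have "(\<Sum>e\<in>out_arcs G v. mon [Edge e, Ghost e]) \<in> J" by (rule J_sum)
  then show "v \<in> vertices_in G J"
    using regular_vertex_relator[of v] J_mem_cong v by (auto simp: vertices_in_def regular_vertex_def)
qed (auto simp: vertices_in_def)

section \<open>Combinations of closed paths at one vertex\<close>

context lpa_preideal_ext
begin

lemma J'_scal: "p \<in> J' \<Longrightarrow> scal c * p \<in> J'"
  by (rule free_idealD(4)[OF ideal'])

lemma J'_single: "Poly_Mapping.single w c \<in> J' \<Longrightarrow> c \<noteq> 0 \<Longrightarrow> mon w \<in> J'"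
  using J'_scal[of "Poly_Mapping.single w c" "1 / c"] by (simp add: single_mult_single)

lemma vertex_in_of_exit:
  assumes p: "p \<in> J'" "Poly_Mapping.keys p \<subseteq> {walk_word v q | q. awalk v q v}"
      "walk_word v [] \<in> Poly_Mapping.keys p"
    and c: "awalk v c v" "c \<noteq> []"
    and d: "awalk v d r" "\<And>m. \<not> prefix d (list_power (min_cycle v) m)"
  shows "r \<in> vertices_in G J'"
proof -
  \<comment> \<open>One exponent serves all closed walks in \<open>p\<close>:
    \<open>not_prefix_cycle_shift\<close> asks for \<open>n\<close> to bound their lengths.\<close>
  define n where "n = Max (length ` Poly_Mapping.keys p)"
  define \<mu> where "\<mu> = list_power (min_cycle v) n @ d"
  have \<mu>: "awalk v \<mu> r"
    unfolding \<mu>_def by (rule awalk_appendI[OF awalk_list_power[OF awalk_min_cycle[OF c]] d(1)])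
  then have r: "awalk r [] r" using awalk_last_in_verts by (simp add: awalk_Nil_iff)
  let ?h = "\<lambda>w. if w = walk_word v [] then Some [Vertex r] else None"
  have "mon (ghost_word \<mu>) * p * mon (walk_word v \<mu>) -
    (\<Sum>w\<in>Poly_Mapping.keys p. case ?h w of None \<Rightarrow> 0
      | Some w' \<Rightarrow> Poly_Mapping.single w' (Poly_Mapping.lookup p w)) \<in> J"
  proof (rule linear_lift)
    fix w assume w: "w \<in> Poly_Mapping.keys p"
    then obtain q where q: "w = walk_word v q" "awalk v q v" using p(2) by blast
    have "length w \<le> n" using w by (simp add: n_def)
    then have len: "length q \<le> n" using q(1) by (simp add: walk_word_def)
    have q\<mu>: "awalk v (q @ \<mu>) r" by (rule awalk_appendI[OF q(2) \<mu>])
    have 1: "word_cong (ghost_word \<mu> @ w @ walk_word v \<mu>) (ghost_word \<mu> @ walk_word v (q @ \<mu>))"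
      unfolding q(1) by (rule word_cong_left[OF word_cong_walk_walk[OF q(2) \<mu>] set_ghost_word[OF \<mu>]])
    show "case ?h w of None \<Rightarrow> word_zero (ghost_word \<mu> @ w @ walk_word v \<mu>)
      | Some w' \<Rightarrow> word_cong (ghost_word \<mu> @ w @ walk_word v \<mu>) w'"
    proof (cases "q = []")
      case True
      have "word_cong (ghost_word \<mu> @ walk_word v \<mu>) [Vertex r]"
        using word_cong_ghost_word[OF \<mu> r] by (simp add: walk_word_def)
      then show ?thesis using word_cong_trans[OF 1] True q(1) by simp
    next
      case False
      have "\<not> prefix \<mu> (q @ \<mu>)"
        unfolding \<mu>_def by (rule not_prefix_cycle_shift[OF d(2) q(2) False len])
      then have "word_zero (ghost_word \<mu> @ walk_word v (q @ \<mu>))"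
        using word_zero_ghost_word[OF \<mu> q\<mu>] by simp
      then show ?thesis using word_cong_zero_iff[OF 1] False q(1) by simp
    qed
  qed
  also have "(\<Sum>w\<in>Poly_Mapping.keys p. case ?h w of None \<Rightarrow> 0
      | Some w' \<Rightarrow> Poly_Mapping.single w' (Poly_Mapping.lookup p w)) =
    (\<Sum>w\<in>Poly_Mapping.keys p. if walk_word v [] = w then Poly_Mapping.single [Vertex r] (Poly_Mapping.lookup p w) else 0)"
    by (rule sum.cong) auto
  also have "\<dots> = Poly_Mapping.single [Vertex r] (Poly_Mapping.lookup p (walk_word v []))"
    using p(3) by (simp add: sum.delta)
  finally have "mon (ghost_word \<mu>) * p * mon (walk_word v \<mu>) -
    Poly_Mapping.single [Vertex r] (Poly_Mapping.lookup p (walk_word v [])) \<in> J" .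
  moreover have "mon (ghost_word \<mu>) * p * mon (walk_word v \<mu>) \<in> J'"
    by (rule J'_mon_mult[OF p(1) set_ghost_word[OF \<mu>] set_walk_word[OF \<mu>]])
  ultimately have "Poly_Mapping.single [Vertex r] (Poly_Mapping.lookup p (walk_word v [])) \<in> J'"
    using J'_mem_cong by blast
  then have "mon [Vertex r] \<in> J'"
    by (rule J'_single) (use p(3) in \<open>simp add: in_keys_iff\<close>)
  then show ?thesis using r by (simp add: vertices_in_def awalk_Nil_iff)
qed

text \<open>Supplies the hypothesis of \<open>reduction_to_closed_walks\<close> by cases on
  \<open>v\<close>. If no nonempty closed walk passes through \<open>v\<close>, then
  \<open>p\<close> is a nonzero multiple of \<open>v\<close>; if there is an exit,
  \<open>vertex_in_of_exit\<close> applies. In both cases \<open>J'\<close> would contain a vertex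
  that is not in \<open>J\<close>.\<close>

lemma closed_walk_comb_mem:
  assumes H: "vertices_in G J' = vertices_in G J"
    and ne: "\<And>v p. no_exit (vertices_in G J) v \<Longrightarrow> p \<in> J' \<Longrightarrow>
      Poly_Mapping.keys p \<subseteq> {walk_word v q | q. awalk v q v} \<Longrightarrow> p \<in> J"
    and p: "p \<in> J'" "Poly_Mapping.keys p \<subseteq> {walk_word v q | q. awalk v q v}"
      "walk_word v [] \<in> Poly_Mapping.keys p"
  shows "p \<in> J"
proof -
  have v: "v \<in> verts G" using p(2,3) by (auto simp: awalk_Nil_iff)
  consider "v \<in> vertices_in G J" | "no_exit (vertices_in G J) v" |
    "v \<notin> vertices_in G J" "\<nexists>c. awalk v c v \<and> c \<noteq> []" |
    c where "v \<notin> vertices_in G J" "\<not> no_exit (vertices_in G J) v" "awalk v c v" "c \<noteq> []" by blast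
  then show ?thesis
  proof cases
    case 1
    then have n: "word_zero [Vertex v]" by (simp add: vertices_in_word_zero)
    have "Poly_Mapping.single w (Poly_Mapping.lookup p w) \<in> J" if w: "w \<in> Poly_Mapping.keys p" for w
    proof -
      obtain q where "w = walk_word v q" "awalk v q v" using p(2) w by blast
      then have "mon w \<in> J" using word_zero_walk[OF n] by (simp add: word_zero_def)
      then show ?thesis by (subst single_conv_scal) (rule J_scal)
    qed
    then have "(\<Sum>w\<in>Poly_Mapping.keys p. Poly_Mapping.single w (Poly_Mapping.lookup p w)) \<in> J"
      by (rule J_sum)
    then show ?thesis by (simp flip: sum_monomials)
  next
    case 2
    then show ?thesis using ne p by blast
  next
    case 3
    then have "Poly_Mapping.keys p = {walk_word v []}" using p(2,3) by blast
    then have "p = Poly_Mapping.single (walk_word v []) (Poly_Mapping.lookup p (walk_word v []))"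
      using sum_monomials[of p] by simp
    then have "mon [Vertex v] \<in> J'"
      using J'_single[of "[Vertex v]"] p(1,3) by (metis in_keys_iff list.map_disc_iff walk_word_def)
    then show ?thesis using 3(1) v H by (auto simp: vertices_in_def)
  next
    case (4 c)
    obtain d r where "awalk v d r" "r \<notin> vertices_in G J" "\<And>m. \<not> prefix d (list_power (min_cycle v) m)"
      using exit_walk[OF v 4(1,3,4,2)] by metis
    then show ?thesis using vertex_in_of_exit[OF p 4(3,4)] H by blast
  qed
qed

text \<open>One base point represents a whole cycle. The element \<open>h' p h\<close> lives at
  \<open>u\<close>, hence lies in \<open>J\<close>, and therefore so does \<open>g p g\<close> for
  \<open>g = h h'\<close>. Closed walks at \<open>v\<close> commute, so \<open>g q g = g g q\<close>
  for each walk \<open>q\<close> in \<open>p\<close>, and \<open>g^* g = v\<close> cancels both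
  copies of \<open>g\<close> from the left.\<close>

lemma no_exit_transport:
  assumes v: "no_exit H v" and vu: "awalk v h u" and uv: "awalk u h' v"
    and mem: "\<And>p. p \<in> J' \<Longrightarrow> Poly_Mapping.keys p \<subseteq> {walk_word u q | q. awalk u q u} \<Longrightarrow> p \<in> J"
    and p: "p \<in> J'" "Poly_Mapping.keys p \<subseteq> {walk_word v q | q. awalk v q v}"
  shows "p \<in> J"
proof -
  let ?W = "{walk_word u q | q. awalk u q u}"
  have "word_zero (walk_word u h' @ w @ walk_word v h) \<or> (\<exists>w'\<in>?W. word_cong (walk_word u h' @ w @ walk_word v h) w')"
    if w: "w \<in> Poly_Mapping.keys p" for w
  proof -
    obtain q where q: "w = walk_word v q" "awalk v q v" using p(2) w by blast
    have qh: "awalk v (q @ h) u" by (rule awalk_appendI[OF q(2) vu])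
    have "word_cong (walk_word u h' @ w @ walk_word v h) (walk_word u h' @ walk_word v (q @ h))"
      unfolding q(1) by (rule word_cong_left[OF word_cong_walk_walk[OF q(2) vu] set_walk_word[OF uv]])
    also have "word_cong \<dots> (walk_word u (h' @ q @ h))" by (rule word_cong_walk_walk[OF uv qh])
    finally show ?thesis using awalk_appendI[OF uv qh] by blast
  qed
  then obtain p' where p': "Poly_Mapping.keys p' \<subseteq> ?W" "mon (walk_word u h') * p * mon (walk_word v h) - p' \<in> J"
    by (rule linear_lift_ex[of p "walk_word u h'" "walk_word v h" ?W])
  have "mon (walk_word u h') * p * mon (walk_word v h) \<in> J'"
    by (rule J'_mon_mult[OF p(1) set_walk_word[OF uv] set_walk_word[OF vu]])
  then have "p' \<in> J'" using p'(2) J'_mem_cong by blast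
  then have "mon (walk_word u h') * p * mon (walk_word v h) \<in> J"
    using mem p' J_mem_cong by blast
  moreover define g where "g = h @ h'"
  moreover have g: "awalk v g v" unfolding g_def by (rule awalk_appendI[OF vu uv])
  \<comment> \<open>The second \<open>g^*\<close> is there for the copy of \<open>g\<close> that
    commutation moves over from the right of \<open>p\<close>.\<close>
  let ?a = "ghost_word g @ ghost_word g @ walk_word v h"
  have a: "set ?a \<subseteq> lpa_gens G"
    using set_ghost_word[OF g] set_walk_word[OF vu] by simp
  ultimately have "mon ?a * (mon (walk_word u h') * p * mon (walk_word v h)) * mon (walk_word u h') \<in> J"
    by (intro J_mon_right[OF J_mon_left[OF _ a] set_walk_word[OF uv]])
  then have mem: "mon (?a @ walk_word u h') * p * mon (walk_word v h @ walk_word u h') \<in> J"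
    by (simp add: single_mult_single mult.assoc flip: mult.assoc[of "mon _" "mon _"])
  have "mon (?a @ walk_word u h') * p * mon (walk_word v h @ walk_word u h') - p \<in> J"
  proof (rule linear_lift_id)
    fix w assume "w \<in> Poly_Mapping.keys p"
    then obtain q where q: "w = walk_word v q" "awalk v q v" using p(2) by blast
    have hh: "word_cong (walk_word v h @ walk_word u h') (walk_word v g)"
      unfolding g_def by (rule word_cong_walk_walk[OF vu uv])
    have qg: "awalk v (q @ g) v" "awalk v (g @ q) v" by (rule awalk_appendI[OF q(2) g] awalk_appendI[OF g q(2)])+
    let ?gg = "ghost_word g @ ghost_word g"
    have gg: "set ?gg \<subseteq> lpa_gens G" using set_ghost_word[OF g] by simp
    have s: "set (w @ walk_word v h @ walk_word u h') \<subseteq> lpa_gens G" "set (?gg @ walk_word v g @ w) \<subseteq> lpa_gens G"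
      "set (?gg @ walk_word v g) \<subseteq> lpa_gens G"
      using set_ghost_word[OF g] set_walk_word[OF g] set_walk_word[OF q(2)] set_walk_word[OF vu]
        set_walk_word[OF uv] by (simp_all add: q(1))
    have "word_cong (?gg @ (walk_word v h @ walk_word u h') @ w @ walk_word v h @ walk_word u h')
      (?gg @ walk_word v g @ w @ walk_word v h @ walk_word u h')"
      by (rule word_cong_ctx[OF hh gg s(1)])
    also have "word_cong \<dots> (?gg @ walk_word v g @ w @ walk_word v g)"
      using word_cong_left[OF hh s(2)] by simp
    also have "word_cong \<dots> (?gg @ walk_word v g @ walk_word v (q @ g))"
      using word_cong_left[OF word_cong_walk_walk[OF q(2) g] s(3)] q(1) by simp
    also have "word_cong \<dots> (?gg @ walk_word v (g @ q @ g))"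
      by (rule word_cong_left[OF word_cong_walk_walk[OF g qg(1)] gg])
    also have "g @ q @ g = g @ g @ q"
      using no_exit_commute[OF v q(2) g] by simp
    also have "word_cong (?gg @ walk_word v (g @ g @ q)) (ghost_word g @ walk_word v (g @ q))"
      using word_cong_left[OF word_cong_ghost_word[OF g qg(2)] set_ghost_word[OF g]] by simp
    also have "word_cong \<dots> w"
      unfolding q(1) by (rule word_cong_ghost_word[OF g q(2)])
    finally show "word_cong ((?a @ walk_word u h') @ w @ walk_word v h @ walk_word u h') w" by simp
  qed
  then show ?thesis using mem J_mem_cong by blast
qed

end

section \<open>Polynomials in a cycle without exit\<close>

text \<open>By division with remainder, a nonzero element of least degree in the union divides every
  element of the union. The chain is constant from the first member on that contains it.\<close>

lemma poly_ideal_chain_stabilizes: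
  fixes F :: "nat \<Rightarrow> 'k::field poly set"
  assumes mono: "\<And>m n. m \<le> n \<Longrightarrow> F m \<subseteq> F n"
    and diff: "\<And>n p q. p \<in> F n \<Longrightarrow> q \<in> F n \<Longrightarrow> p - q \<in> F n"
    and mult: "\<And>n p q. p \<in> F n \<Longrightarrow> q * p \<in> F n"
  shows "\<exists>N. \<forall>n\<ge>N. F n = F N"
proof (cases "(\<Union>n. F n) \<subseteq> {0}")
  case True
  show ?thesis
  \<comment> \<open>Closure under differences does not provide \<open>0\<close> in an empty set, so
    the members may start out empty; the chain then changes at most once, from \<open>{}\<close> to
    \<open>{0}\<close>.\<close>
  proof (cases "\<exists>N. F N \<noteq> {}")
    case True': True
    then obtain N p where "p \<in> F N" by blast
    then have "F n = {0}" if "n \<ge> N" for n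
      using mono[OF that] True by (metis UN_upper UNIV_I subset_singletonD subset_trans empty_iff subsetD)
    then show ?thesis by (metis order_refl)
  qed auto
next
  case False
  define P where "P p \<longleftrightarrow> p \<in> (\<Union>n. F n) \<and> p \<noteq> 0" for p
  from False obtain p where "P p" by (auto simp: P_def)
  define m where "m = arg_min degree P"
  have m: "P m" "\<And>q. P q \<Longrightarrow> degree m \<le> degree q"
    using arg_min_nat_lemma[of P, OF \<open>P p\<close>, of degree] by (auto simp: m_def)
  then obtain N where N: "m \<in> F N" "m \<noteq> 0" by (auto simp: P_def)
  have "F n \<subseteq> F N" if "n \<ge> N" for n
  proof
    fix q assume q: "q \<in> F n"
    have "q - q div m * m \<in> F n"
      using diff[OF q mult[of m n "q div m"]] mono[OF that] N(1) by blast
    then have "q mod m \<in> F n" by (simp add: minus_div_mult_eq_mod)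
    then have "\<not> P (q mod m) \<Longrightarrow> q mod m = 0" by (auto simp: P_def)
    then have "q mod m = 0"
      using degree_mod_less[OF N(2), of q] m(2)[of "q mod m"] by linarith
    then have "q = q div m * m" by (metis div_mult_mod_eq add.right_neutral)
    then show "q \<in> F N" using mult[OF N(1)] by metis
  qed
  then show ?thesis using mono by blast
qed

context wf_digraph
begin

text \<open>Evaluation of \<open>P\<close> at the cycle \<open>min_cycle v\<close>, with
  \<open>v\<close> in the role of \<open>1\<close>.\<close>

definition cycle_poly :: "'a \<Rightarrow> 'k::field poly \<Rightarrow> ('k, 'a, 'b) free_elem" where
  "cycle_poly v P = (\<Sum>i\<le>degree P. Poly_Mapping.single (walk_word v (list_power (min_cycle v) i)) (coeff P i))"

text \<open>A common upper limit allows polynomials of different degrees to be added.\<close>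

lemma cycle_poly_bound:
  assumes "degree P \<le> n"
  shows "cycle_poly v P = (\<Sum>i\<le>n. Poly_Mapping.single (walk_word v (list_power (min_cycle v) i)) (coeff P i))"
  unfolding cycle_poly_def
  by (rule sum.mono_neutral_left) (use assms in \<open>auto simp: coeff_eq_0\<close>)

lemma cycle_poly_add: "cycle_poly v (P + Q) = cycle_poly v P + cycle_poly v Q"
proof -
  let ?n = "max (degree P) (degree Q)"
  have "degree (P + Q) \<le> ?n" by (rule degree_add_le_max)
  then show ?thesis
    using cycle_poly_bound[of P ?n v] cycle_poly_bound[of Q ?n v] cycle_poly_bound[of "P + Q" ?n v]
    by (simp add: single_add sum.distrib)
qed

lemma cycle_poly_0 [simp]: "cycle_poly v 0 = 0"
  by (simp add: cycle_poly_def)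

lemma cycle_poly_smult: "cycle_poly v (smult c P) = scal c * cycle_poly v P"
  using cycle_poly_bound[OF degree_smult_le[of c P], of v]
  by (simp add: cycle_poly_def sum_distrib_left single_mult_single)

text \<open>Multiplication by the indeterminate becomes right multiplication by the cycle, so
  absorption in an ideal of the free algebra yields absorption in \<open>K[x]\<close>.\<close>

lemma cycle_poly_pCons:
  "cycle_poly v (pCons 0 P) = cycle_poly v P * mon (map Edge (min_cycle v))"
proof -
  have pow: "list_power c i @ c = c @ list_power c i" for c :: "'b list" and i
    using list_power_add[of i 1 c] by simp
  have "cycle_poly v (pCons 0 P) = (\<Sum>i\<le>Suc (degree P).
    Poly_Mapping.single (walk_word v (list_power (min_cycle v) i)) (coeff (pCons 0 P) i))"
    by (rule cycle_poly_bound) (simp add: degree_pCons_le)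
  also have "\<dots> = (\<Sum>i\<le>degree P.
    Poly_Mapping.single (walk_word v (list_power (min_cycle v) (Suc i))) (coeff P i))"
    by (subst sum.atMost_Suc_shift) simp
  also have "\<dots> = cycle_poly v P * mon (map Edge (min_cycle v))"
    unfolding cycle_poly_def sum_distrib_right
    by (rule sum.cong) (simp_all add: single_mult_single walk_word_def pow flip: map_append)
  finally show ?thesis .
qed

lemma cycle_poly_surj:
  assumes "no_exit H v" "Poly_Mapping.keys p \<subseteq> {walk_word v q | q. awalk v q v}"
  shows "\<exists>P. cycle_poly v P = p"
proof -
  have "\<exists>j. w = walk_word v (list_power (min_cycle v) j)" if "w \<in> Poly_Mapping.keys p" for w
    using assms(2) that no_exit_closed_power[OF assms(1)] by blast
  then obtain j where j: "w = walk_word v (list_power (min_cycle v) (j w))" if "w \<in> Poly_Mapping.keys p" for w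
    by metis
  have m: "cycle_poly v (monom c i) = Poly_Mapping.single (walk_word v (list_power (min_cycle v) i)) c"
    for c :: "'c::field" and i
    using cycle_poly_bound[OF degree_monom_le[of c i], of v]
    by (simp add: if_distrib[of "Poly_Mapping.single _"] sum.delta' cong: if_cong)
  have s: "cycle_poly v (sum f A) = (\<Sum>x\<in>A. cycle_poly v (f x))" for f :: "('a, 'b) lpa_gen list \<Rightarrow> 'c poly" and A
    by (induct A rule: infinite_finite_induct) (simp_all add: cycle_poly_add)
  have "cycle_poly v (\<Sum>w\<in>Poly_Mapping.keys p. monom (Poly_Mapping.lookup p w) (j w)) =
    (\<Sum>w\<in>Poly_Mapping.keys p. Poly_Mapping.single w (Poly_Mapping.lookup p w))"
    unfolding s m by (rule sum.cong) (use j in auto)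
  then show ?thesis using sum_monomials[of p] by metis
qed

lemma cycle_poly_ideal:
  assumes "two_sided_ideal (free_lpa K G) J" "no_exit H v"
  shows "cycle_poly v P \<in> J \<Longrightarrow> cycle_poly v Q \<in> J \<Longrightarrow> cycle_poly v (P - Q) \<in> J"
    and "cycle_poly v P \<in> J \<Longrightarrow> cycle_poly v (Q * P) \<in> J"
proof -
  have sm: "cycle_poly v P \<in> J \<Longrightarrow> cycle_poly v (smult c P) \<in> J" for c P
    using free_idealD(4)[OF assms(1)] by (simp add: cycle_poly_smult)
  show "cycle_poly v P \<in> J \<Longrightarrow> cycle_poly v Q \<in> J \<Longrightarrow> cycle_poly v (P - Q) \<in> J"
    using free_idealD(3)[OF assms(1), of "cycle_poly v P" "cycle_poly v (smult (- 1) Q)"] sm[of Q "- 1"]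
    by (simp flip: cycle_poly_add)
  have "set (map Edge (min_cycle v)) \<subseteq> lpa_gens G"
    using assms(2) awalk_min_cycle set_map_Edge unfolding no_exit_def by (metis list.set_map)
  then have shift: "cycle_poly v P \<in> J \<Longrightarrow> cycle_poly v (pCons 0 P) \<in> J" for P
    using free_idealD(10)[OF assms(1)] by (simp add: cycle_poly_pCons)
  show "cycle_poly v (Q * P) \<in> J" if "cycle_poly v P \<in> J"
  proof (induct Q)
    case 0
    then show ?case using free_idealD(2)[OF assms(1)] by simp
  next
    case (pCons c Q)
    then show ?case
      using free_idealD(3)[OF assms(1) sm[OF that, of c] shift] by (simp add: mult_pCons_left cycle_poly_add)
  qed
qed

end

section \<open>Ascending chains\<close>

lemma satisfies_acc_maximal:
  assumes "satisfies_acc \<F>" "\<A> \<subseteq> \<F>" "\<A> \<noteq> {}"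
  shows "\<exists>M\<in>\<A>. \<forall>B\<in>\<A>. M \<subseteq> B \<longrightarrow> B = M"
proof (rule ccontr)
  assume "\<not> ?thesis"
  then have ex: "\<exists>B. B \<in> \<A> \<and> A \<subset> B" if "A \<in> \<A>" for A using that by blast
  have "\<exists>C. \<forall>n. C n \<in> \<A> \<and> C n \<subset> C (Suc n)"
    by (rule dependent_nat_choice) (use assms(3) ex in blast)+
  then obtain C where C: "\<forall>n. C n \<in> \<A> \<and> C n \<subset> C (Suc n)" ..
  then have "\<forall>n. C n \<in> \<F> \<and> C n \<subseteq> C (Suc n)" using assms(2) by blast
  then have "\<exists>N. \<forall>n\<ge>N. C n = C N"
    by (rule assms(1)[unfolded satisfies_acc_def, THEN spec, THEN mp])
  then obtain N where "\<forall>n\<ge>N. C n = C N" ..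
  then have "C (Suc N) = C N" using le_Suc_eq by blast
  then show False using C by blast
qed

section \<open>Hereditary saturated sets and finitely many cycles without exit\<close>

context wf_digraph
begin

lemma hereditary_saturated_hs_closure:
  assumes "X \<subseteq> verts G"
  shows "hereditary G (hs_closure G X)" "saturated G (hs_closure G X)"
proof -
  let ?T = "{H. (hereditary G H \<and> saturated G H) \<and> X \<subseteq> H}"
  have V: "verts G \<in> ?T"
    using assms awalk_last_in_verts
    by (auto simp: hereditary_def saturated_def vertex_ge_def regular_vertex_def)
  have "hereditary G (\<Inter> ?T)"
    unfolding hereditary_def[of G "\<Inter> ?T"]
  proof (intro conjI ballI allI impI)
    fix w v assume w: "w \<in> \<Inter> ?T" "vertex_ge G w v"
    have "v \<in> H" if "H \<in> ?T" for H
      using that w unfolding hereditary_def by blast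
    then show "v \<in> \<Inter> ?T" by blast
  qed (use V in blast)
  then show "hereditary G (hs_closure G X)" unfolding hs_closure_def hull_def .
  have "saturated G (\<Inter> ?T)"
    unfolding saturated_def[of G "\<Inter> ?T"]
  proof (intro conjI allI impI)
    fix v assume v: "regular_vertex G v \<and> head G ` out_arcs G v \<subseteq> \<Inter> ?T"
    have "v \<in> H" if "H \<in> ?T" for H
      using that v unfolding saturated_def by blast
    then show "v \<in> \<Inter> ?T" by blast
  qed (use V in blast)
  then show "saturated G (hs_closure G X)" unfolding hs_closure_def hull_def .
qed

lemma hs_closure_eq: "hereditary G H \<Longrightarrow> saturated G H \<Longrightarrow> hs_closure G H = H"
  unfolding hs_closure_def by (rule hull_same) simp

lemma hs_closure_minimal: "X \<subseteq> H \<Longrightarrow> hereditary G H \<Longrightarrow> saturated G H \<Longrightarrow> hs_closure G X \<subseteq> H"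
  unfolding hs_closure_def by (rule hull_minimal) simp_all

text \<open>Allows (3) to be used as the chain condition on all hereditary saturated sets.\<close>

lemma hs_closures: "{hs_closure G X | X. X \<subseteq> verts G} = {H. hereditary G H \<and> saturated G H}"
proof (intro equalityI subsetI)
  fix H assume "H \<in> {H. hereditary G H \<and> saturated G H}"
  then have "H = hs_closure G H" "H \<subseteq> verts G"
    by (auto simp: hs_closure_eq hereditary_def)
  then show "H \<in> {hs_closure G X | X. X \<subseteq> verts G}" by blast
qed (use hereditary_saturated_hs_closure in blast)

lemma vertex_ge_trans: "vertex_ge G u v \<Longrightarrow> vertex_ge G v w \<Longrightarrow> vertex_ge G u w"
  unfolding vertex_ge_def using awalk_appendI by blast

text \<open>The vertices which do not connect to \<open>v\<close> form a hereditary and saturated set. Hence a cycle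
  without exit is never in the closure of \<open>H\<close> and other such cycles, and the chain condition leaves
  room for only finitely many of them.\<close>

lemma not_vertex_ge_hereditary_saturated:
  assumes "awalk v c v" "c \<noteq> []"
  shows "hereditary G {u \<in> verts G. \<not> vertex_ge G u v}" "saturated G {u \<in> verts G. \<not> vertex_ge G u v}"
proof -
  show "hereditary G {u \<in> verts G. \<not> vertex_ge G u v}"
    unfolding hereditary_def
  proof (intro conjI ballI allI impI)
    fix u w assume u: "u \<in> {u \<in> verts G. \<not> vertex_ge G u v}" and uw: "vertex_ge G u w"
    then have "w \<in> verts G" using awalk_last_in_verts unfolding vertex_ge_def by blast
    then show "w \<in> {u \<in> verts G. \<not> vertex_ge G u v}" using vertex_ge_trans[OF uw] u by blast
  qed auto
  show "saturated G {u \<in> verts G. \<not> vertex_ge G u v}"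
    unfolding saturated_def
  proof (intro conjI allI impI)
    fix u assume u: "regular_vertex G u \<and> head G ` out_arcs G u \<subseteq> {u \<in> verts G. \<not> vertex_ge G u v}"
    have "\<not> vertex_ge G u v"
    proof
      assume "vertex_ge G u v"
      then obtain q where q: "awalk u q v" by (auto simp: vertex_ge_def)
      \<comment> \<open>For \<open>u = v\<close> the cycle replaces the trivial walk, so that there
        is a first edge to follow.\<close>
      have "\<exists>q. awalk u q v \<and> q \<noteq> []"
      proof (cases "q = []")
        case True
        then have "u = v" using q by (simp add: awalk_Nil_iff)
        then show ?thesis using assms by blast
      qed (use q in blast)
      then obtain e r where "awalk u (e # r) v" by (metis list.exhaust)
      then have "e \<in> out_arcs G u" "vertex_ge G (head G e) v"
        by (auto simp: awalk_Cons_iff vertex_ge_def)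
      then show False using u by blast
    qed
    then show "u \<in> {u \<in> verts G. \<not> vertex_ge G u v}" using u by (simp add: regular_vertex_def)
  qed auto
qed

text \<open>A closure of \<open>H \<union> F\<close> that is maximal among finite \<open>F\<close>
  already contains every further \<open>v\<close>. The vertices that do not connect to
  \<open>v\<close> form a hereditary saturated set which contains \<open>H\<close> but not
  \<open>v\<close>, so it cannot contain \<open>F\<close>. Hence some \<open>u \<in> F\<close>
  connects to \<open>v\<close>, and \<open>no_exit_return\<close> at \<open>u\<close> leads
  back.\<close>

lemma no_exit_representatives:
  assumes acc: "satisfies_acc {hs_closure G X | X. X \<subseteq> verts G}"
    and H: "hereditary G H"
  obtains F where "finite F" "F \<subseteq> {v. no_exit H v}"
    "\<And>v. no_exit H v \<Longrightarrow> \<exists>u\<in>F. (\<exists>q. awalk u q v) \<and> (\<exists>q. awalk v q u)"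
proof -
  let ?\<A> = "{hs_closure G (H \<union> F) | F. finite F \<and> F \<subseteq> {v. no_exit H v}}"
  have HV: "H \<subseteq> verts G" using H by (simp add: hereditary_def)
  have sub: "H \<union> F \<subseteq> verts G" if "F \<subseteq> {v. no_exit H v}" for F
    using that HV by (auto simp: no_exit_def)
  have "?\<A> \<subseteq> {hs_closure G X | X. X \<subseteq> verts G}" using sub by blast
  moreover have "?\<A> \<noteq> {}" by blast
  ultimately obtain M where "M \<in> ?\<A>" and M: "\<And>B. B \<in> ?\<A> \<Longrightarrow> M \<subseteq> B \<Longrightarrow> B = M"
    using satisfies_acc_maximal[OF acc, of ?\<A>] by auto
  then obtain F where F: "finite F" "F \<subseteq> {v. no_exit H v}" "M = hs_closure G (H \<union> F)" by blast
  have "\<exists>u\<in>F. (\<exists>q. awalk u q v) \<and> (\<exists>q. awalk v q u)" if v: "no_exit H v" for v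
  proof -
    have "hs_closure G (H \<union> insert v F) \<in> ?\<A>" using F(1,2) v by blast
    moreover have "M \<subseteq> hs_closure G (H \<union> insert v F)"
      unfolding F(3) hs_closure_def by (rule hull_mono) blast
    ultimately have "hs_closure G (H \<union> insert v F) = M" by (rule M)
    moreover have "v \<in> hs_closure G (H \<union> insert v F)"
      unfolding hs_closure_def by (rule hull_inc) simp
    ultimately have vM: "v \<in> hs_closure G (H \<union> F)" using F(3) by simp
    let ?S = "{u \<in> verts G. \<not> vertex_ge G u v}"
    obtain c where c: "awalk v c v" "c \<noteq> []" and vH: "v \<in> verts G" "v \<notin> H"
      using v by (auto simp: no_exit_def)
    have "vertex_ge G v v" using c(1) by (auto simp: vertex_ge_def)
    then have "\<not> H \<union> F \<subseteq> ?S"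
      using hs_closure_minimal[OF _ not_vertex_ge_hereditary_saturated[OF c], of "H \<union> F"] vM by blast
    moreover have "H \<subseteq> ?S" using H vH HV by (auto simp: hereditary_def)
    ultimately obtain u where u: "u \<in> F" "vertex_ge G u v" using sub[OF F(2)] by blast
    then obtain q where q: "awalk u q v" by (auto simp: vertex_ge_def)
    moreover have "\<exists>q. awalk v q u"
      by (rule no_exit_return[OF _ q vH(2)]) (use u F(2) in blast)
    ultimately show ?thesis using u by blast
  qed
  with F that show ?thesis by blast
qed

text \<open>From some index on two data are fixed: the vertices in the members, and, for each of the
  finitely many representatives of cycles without exit, the ideal of \<open>K[x]\<close> cut out by
  the members. These determine the members, since \<open>no_exit_transport\<close> carries
  membership from the representatives to all other vertices on such cycles.\<close>

theorem ideal_chain_stabilizes: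
  fixes K :: "'k::field itself" and I :: "nat \<Rightarrow> ('k, 'a, 'b) free_elem set"
  assumes rf: "row_finite G"
    and acc: "satisfies_acc {hs_closure G X | X. X \<subseteq> verts G}"
    and I: "\<And>n. lpa_preideal G K (I n)" "\<And>n. I n \<subseteq> I (Suc n)"
  shows "\<exists>N. \<forall>n\<ge>N. I n = I N"
proof -
  have mono: "I m \<subseteq> I n" if "m \<le> n" for m n
    by (rule lift_Suc_mono_le[of I, OF I(2) that])
  have id: "two_sided_ideal (free_lpa K G) (I n)" for n
    using I(1) by (rule lpa_preideal.ideal)
  have "\<exists>N. \<forall>n\<ge>N. vertices_in G (I n) = vertices_in G (I N)"
  proof -
    have "vertices_in G (I n) \<in> {hs_closure G X | X. X \<subseteq> verts G}" for n
      using lpa_preideal.hereditary_vertices_in[OF I(1)] lpa_preideal.saturated_vertices_in[OF I(1)]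
      by (simp only: hs_closures) blast
    moreover have "vertices_in G (I n) \<subseteq> vertices_in G (I (Suc n))" for n
      using I(2)[of n] by (auto simp: vertices_in_def)
    ultimately have "\<forall>n. vertices_in G (I n) \<in> {hs_closure G X | X. X \<subseteq> verts G} \<and>
        vertices_in G (I n) \<subseteq> vertices_in G (I (Suc n))" by simp
    then show ?thesis by (rule acc[unfolded satisfies_acc_def, THEN spec, THEN mp])
  qed
  then obtain N0 where N0: "\<And>n. n \<ge> N0 \<Longrightarrow> vertices_in G (I n) = vertices_in G (I N0)" by blast
  define H where "H = vertices_in G (I N0)"
  have "hereditary G H"
    unfolding H_def using I(1) by (rule lpa_preideal.hereditary_vertices_in)
  then obtain F where F: "finite F" "F \<subseteq> {v. no_exit H v}"
    "\<And>v. no_exit H v \<Longrightarrow> \<exists>u\<in>F. (\<exists>q. awalk u q v) \<and> (\<exists>q. awalk v q u)"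
    using no_exit_representatives[OF acc] by blast
  have "\<exists>N. \<forall>n\<ge>N. {P. cycle_poly u P \<in> I n} = {P. cycle_poly u P \<in> I N}" if u: "u \<in> F" for u
  proof (rule poly_ideal_chain_stabilizes)
    have nu: "no_exit H u" using u F(2) by blast
    show "P - Q \<in> {P. cycle_poly u P \<in> I n}"
      if "P \<in> {P. cycle_poly u P \<in> I n}" "Q \<in> {P. cycle_poly u P \<in> I n}" for P Q n
      using cycle_poly_ideal(1)[OF id nu] that by blast
    show "Q * P \<in> {P. cycle_poly u P \<in> I n}" if "P \<in> {P. cycle_poly u P \<in> I n}" for P Q n
      using cycle_poly_ideal(2)[OF id nu] that by blast
  qed (use mono in blast)
  then obtain N1 where N1: "\<And>u n. u \<in> F \<Longrightarrow> n \<ge> N1 u \<Longrightarrow>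
      {P. cycle_poly u P \<in> I n} = {P. cycle_poly u P \<in> I (N1 u)}" by metis
  define N where "N = Max (insert N0 (N1 ` F))"
  have N: "N0 \<le> N" "\<And>u. u \<in> F \<Longrightarrow> N1 u \<le> N"
    using F(1) by (auto simp: N_def)
  have "I n \<subseteq> I N" if n: "n \<ge> N" for n
  proof -
    interpret lpa_preideal G K "I N" by (rule I(1))
    interpret lpa_preideal_ext G K "I N" "I n"
      by unfold_locales (rule id, rule mono[OF n], rule rf)
    have H': "vertices_in G (I n) = H" "vertices_in G (I N) = H"
      using N0[of n] N0[of N] N(1) n by (auto simp: H_def)
    have F_mem: "p \<in> I N" if u: "u \<in> F"
      and p: "p \<in> I n" "Poly_Mapping.keys p \<subseteq> {walk_word u q | q. awalk u q u}" for u p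
    proof -
      have nu: "no_exit H u" using u F(2) by blast
      obtain P where P: "cycle_poly u P = p" using cycle_poly_surj[OF nu p(2)] by blast
      have "{P. cycle_poly u P \<in> I n} = {P. cycle_poly u P \<in> I N}"
        using N1[OF u, of n] N1[OF u, of N] N(2)[OF u] n by simp
      then show ?thesis using P p(1) by blast
    qed
    have ne: "p \<in> I N" if v: "no_exit H v"
      and p: "p \<in> I n" "Poly_Mapping.keys p \<subseteq> {walk_word v q | q. awalk v q v}" for v p
    proof -
      obtain u q q' where u: "u \<in> F" "awalk u q v" "awalk v q' u" using F(3)[OF v] by blast
      show ?thesis
        by (rule no_exit_transport[OF v u(3,2) F_mem[OF u(1)] p])
    qed
    show ?thesis
    proof (rule reduction_to_closed_walks)
      fix v p assume "p \<in> I n" "Poly_Mapping.keys p \<subseteq> {walk_word v q | q. awalk v q v}"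
        "walk_word v [] \<in> Poly_Mapping.keys p"
      then show "p \<in> I N"
        by (rule closed_walk_comb_mem[rotated 2]) (use H' ne in auto)
    qed
  qed
  then show ?thesis using mono by blast
qed

end

section \<open>Representations of the free algebra\<close>

text \<open>Linear extension of \<open>act\<close> to a left action of the free algebra; the first
  letter of a word acts last.\<close>

definition rep :: "('g \<Rightarrow> ('x \<Rightarrow> 'k) \<Rightarrow> 'x \<Rightarrow> 'k) \<Rightarrow> ('g list \<Rightarrow>\<^sub>0 'k::field) \<Rightarrow> ('x \<Rightarrow> 'k) \<Rightarrow> 'x \<Rightarrow> 'k" where
  "rep act p f x = (\<Sum>w\<in>Poly_Mapping.keys p. Poly_Mapping.lookup p w * foldr act w f x)"

definition linear_act :: "('g \<Rightarrow> ('x \<Rightarrow> 'k) \<Rightarrow> 'x \<Rightarrow> 'k::field) \<Rightarrow> bool" where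
  "linear_act act \<longleftrightarrow> (\<forall>g f h. act g (\<lambda>x. f x + h x) = (\<lambda>x. act g f x + act g h x)) \<and>
     (\<forall>g c f. act g (\<lambda>x. c * f x) = (\<lambda>x. c * act g f x))"

lemma rep_superset:
  "finite S \<Longrightarrow> Poly_Mapping.keys p \<subseteq> S \<Longrightarrow> rep act p f x = (\<Sum>w\<in>S. Poly_Mapping.lookup p w * foldr act w f x)"
  unfolding rep_def by (rule sum.mono_neutral_left) (auto simp: in_keys_iff)

lemma rep_add: "rep act (p + q) f x = rep act p f x + rep act q f x"
proof -
  let ?S = "Poly_Mapping.keys p \<union> Poly_Mapping.keys q"
  have "rep act r f x = (\<Sum>w\<in>?S. Poly_Mapping.lookup r w * foldr act w f x)" if "r \<in> {p, q, p + q}" for r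
    by (rule rep_superset) (use that keys_add[of p q] in auto)
  then show ?thesis by (simp add: lookup_add distrib_right sum.distrib)
qed

lemma rep_single [simp]: "rep act (Poly_Mapping.single w c) f x = c * foldr act w f x"
  by (simp add: rep_def)

lemma rep_0 [simp]: "rep act 0 f x = 0"
  by (simp add: rep_def)

lemma rep_sum: "rep act (sum p A) f x = (\<Sum>i\<in>A. rep act (p i) f x)"
  by (induct A rule: infinite_finite_induct) (simp_all add: rep_add)

lemma rep_minus: "rep act (p - q) f x = rep act p f x - rep act q f x"
  using rep_add[of act "p - q" q f x] by simp

lemma linear_act_add: "linear_act act \<Longrightarrow> act g (\<lambda>x. f x + h x) = (\<lambda>x. act g f x + act g h x)"
  unfolding linear_act_def by (drule conjunct1, (drule spec)+, assumption)

lemma linear_act_scale: "linear_act act \<Longrightarrow> act g (\<lambda>x. c * f x) = (\<lambda>x. c * act g f x)"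
  unfolding linear_act_def by (drule conjunct2, (drule spec)+, assumption)

lemma linear_act_zero: "linear_act act \<Longrightarrow> act g (\<lambda>x. 0) = (\<lambda>x. 0)"
  using linear_act_scale[of act g 0 "\<lambda>x. 0"] by simp

lemma linear_act_sum:
  assumes "linear_act act"
  shows "act g (\<lambda>x. \<Sum>i\<in>A. c i * f i x) = (\<lambda>x. \<Sum>i\<in>A. c i * act g (f i) x)"
proof (induct A rule: infinite_finite_induct)
  case (insert i A)
  then show ?case
    by (simp add: linear_act_add[OF assms] linear_act_scale[OF assms])
qed (simp_all add: linear_act_zero[OF assms])

lemma linear_foldr_sum:
  assumes "linear_act act"
  shows "foldr act w (\<lambda>x. \<Sum>i\<in>A. c i * f i x) = (\<lambda>x. \<Sum>i\<in>A. c i * foldr act w (f i) x)"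
  by (induct w) (simp_all add: linear_act_sum[OF assms])

lemma rep_mon_left:
  assumes "linear_act act"
  shows "rep act (mon w * p) f x = foldr act w (rep act p f) x"
proof -
  have "mon w * p = (\<Sum>u\<in>Poly_Mapping.keys p. Poly_Mapping.single (w @ u) (Poly_Mapping.lookup p u))"
    by (subst sum_monomials[of p]) (simp add: sum_distrib_left single_mult_single)
  then have "rep act (mon w * p) f x =
      (\<Sum>u\<in>Poly_Mapping.keys p. Poly_Mapping.lookup p u * foldr act w (foldr act u f) x)"
    by (simp add: rep_sum)
  then show ?thesis
    unfolding rep_def[abs_def] by (simp add: linear_foldr_sum[OF assms])
qed

lemma rep_mon_right: "rep act (p * mon w) f x = rep act p (foldr act w f) x"
proof -
  have "p * mon w = (\<Sum>u\<in>Poly_Mapping.keys p. Poly_Mapping.single (u @ w) (Poly_Mapping.lookup p u))"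
    by (subst sum_monomials[of p]) (simp add: sum_distrib_right single_mult_single)
  then show ?thesis by (simp add: rep_sum rep_def[of act p])
qed

text \<open>An annihilator that contains the generators of an ideal contains the ideal, so an
  element acting nontrivially is shown to lie outside.\<close>

lemma rep_kernel_ideal:
  fixes act :: "('a, 'b) lpa_gen \<Rightarrow> ('x \<Rightarrow> 'k::field) \<Rightarrow> 'x \<Rightarrow> 'k"
  assumes "linear_act act"
  shows "two_sided_ideal (free_lpa K G) {p \<in> carrier (free_lpa K G). \<forall>f x. rep act p f x = 0}"
proof (rule free_idealI)
  fix p c assume "p \<in> {p \<in> carrier (free_lpa K G). \<forall>f x. rep act p f x = 0}"
  moreover from this have "scal c * p \<in> carrier (free_lpa K G)"
    using keys_scal_mult[of c p] by (auto simp: carrier_free_lpa)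
  moreover have "rep act (scal c * p) f x = c * rep act p f x" for f x
  proof -
    have "scal c * p = (\<Sum>u\<in>Poly_Mapping.keys p. Poly_Mapping.single u (c * Poly_Mapping.lookup p u))"
      by (subst sum_monomials[of p]) (simp add: sum_distrib_left single_mult_single)
    then show ?thesis by (simp add: rep_sum rep_def[of act p] sum_distrib_left mult.assoc)
  qed
  ultimately show "scal c * p \<in> {p \<in> carrier (free_lpa K G). \<forall>f x. rep act p f x = 0}" by simp
next
  fix p :: "('k, 'a, 'b) free_elem" and w :: "('a, 'b) lpa_gen list"
  assume p: "p \<in> {p \<in> carrier (free_lpa K G). \<forall>f x. rep act p f x = 0}" and w: "w \<noteq> []" "set w \<subseteq> lpa_gens G"
  have "foldr act w (\<lambda>x. 0) = (\<lambda>x. 0)"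
    using linear_foldr_sum[OF assms, of w undefined undefined "{}"] by simp
  moreover have "rep act p f = (\<lambda>x. 0)" for f using p by auto
  ultimately show "mon w * p \<in> {p \<in> carrier (free_lpa K G). \<forall>f x. rep act p f x = 0}"
    using p carrier_free_lpa_mult[OF carrier_free_lpa_mon[OF w], of p K] by (simp add: rep_mon_left[OF assms])
  show "p * mon w \<in> {p \<in> carrier (free_lpa K G). \<forall>f x. rep act p f x = 0}"
    using p carrier_free_lpa_mult[OF _ carrier_free_lpa_mon[OF w], of p K] by (simp add: rep_mon_right)
qed (auto simp: zero_carrier_free_lpa carrier_free_lpa_add rep_add)

section \<open>The ideal of a hereditary saturated set\<close>

text \<open>The preimage in the free algebra of the ideal of \<open>L_K(E)\<close> generated by
  \<open>H\<close>.\<close>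

definition hs_ideal :: "'k::field itself \<Rightarrow> ('a, 'b) pre_digraph \<Rightarrow> 'a set \<Rightarrow> ('k, 'a, 'b) free_elem set" where
  "hs_ideal K G H = two_sided_ideal (free_lpa K G) hull (lpa_relators K G \<union> (\<lambda>v. mon [Vertex v]) ` H)"

text \<open>The quotient graph \<open>E/H\<close> acts on the functions on \<open>(E\<^sup>0 \<setminus> H) \<times> \<nat>\<close>: at every vertex \<open>v\<close> the
  bijection \<open>\<beta> v\<close> splits \<open>{v} \<times> \<nat>\<close> into one copy of \<open>\<nat>\<close> for each edge of \<open>E/H\<close> leaving \<open>v\<close>,
  and \<open>\<epsilon> v\<close> is its inverse.\<close>

fun branching_act :: "('a, 'b) pre_digraph \<Rightarrow> 'a set \<Rightarrow> ('a \<Rightarrow> nat \<Rightarrow> 'b \<times> nat) \<Rightarrow> ('a \<Rightarrow> 'b \<times> nat \<Rightarrow> nat) \<Rightarrow>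
    ('a, 'b) lpa_gen \<Rightarrow> ('a \<times> nat \<Rightarrow> 'k::field) \<Rightarrow> 'a \<times> nat \<Rightarrow> 'k" where
  "branching_act G H \<beta> \<epsilon> (Vertex v) f (x, n) = (if x = v \<and> v \<notin> H then f (x, n) else 0)"
| "branching_act G H \<beta> \<epsilon> (Edge e) f (x, n) =
     (if x = tail G e \<and> x \<notin> H \<and> head G e \<notin> H \<and> fst (\<beta> x n) = e then f (head G e, snd (\<beta> x n)) else 0)"
| "branching_act G H \<beta> \<epsilon> (Ghost e) f (x, n) =
     (if x = head G e \<and> x \<notin> H then f (tail G e, \<epsilon> (tail G e) (e, n)) else 0)"

lemma linear_branching_act: "linear_act (branching_act G H \<beta> \<epsilon>)"
  unfolding linear_act_def
proof (intro conjI allI ext)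
  fix g f h and x :: "'a \<times> nat" and c
  obtain y n where x: "x = (y, n)" by (cases x)
  show "branching_act G H \<beta> \<epsilon> g (\<lambda>x. f x + h x) x = branching_act G H \<beta> \<epsilon> g f x + branching_act G H \<beta> \<epsilon> g h x"
    unfolding x by (cases g) auto
  show "branching_act G H \<beta> \<epsilon> g (\<lambda>x. c * f x) x = c * branching_act G H \<beta> \<epsilon> g f x"
    unfolding x by (cases g) auto
qed

context wf_digraph
begin

lemma hs_ideal_preideal:
  assumes "H \<subseteq> verts G"
  shows "lpa_preideal G K (hs_ideal K G H)"
proof
  have "(\<lambda>v. mon [Vertex v]) ` H \<subseteq> carrier (free_lpa K G)"
    using assms by (auto intro!: carrier_free_lpa_mon)
  then show "two_sided_ideal (free_lpa K G) (hs_ideal K G H)"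
    unfolding hs_ideal_def using lpa_relators_carrier by (intro free_ideal_hull) auto
  show "lpa_relators K G \<subseteq> hs_ideal K G H"
    unfolding hs_ideal_def by (auto intro: hull_inc)
qed

lemma hs_ideal_mono: "H \<subseteq> H' \<Longrightarrow> hs_ideal K G H \<subseteq> hs_ideal K G H'"
  unfolding hs_ideal_def by (rule hull_mono) blast

text \<open>The representation of \<open>E/H\<close> annihilates the relators and \<open>H\<close>,
  but no vertex outside \<open>H\<close>. Thus \<open>H\<close> can be recovered from its
  ideal.\<close>

lemma vertices_in_hs_ideal:
  assumes rf: "row_finite G" and her: "hereditary G H" and sat: "saturated G H"
  shows "vertices_in G (hs_ideal K G H) = H"
proof
  have HV: "H \<subseteq> verts G" using her by (simp add: hereditary_def)
  show "H \<subseteq> vertices_in G (hs_ideal K G H)"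
    using HV by (auto simp: vertices_in_def hs_ideal_def intro: hull_inc)
  let ?E = "\<lambda>v. {e \<in> out_arcs G v. head G e \<notin> H}"
  \<comment> \<open>Saturation provides at least one edge from \<open>v\<close> that ends outside
    \<open>H\<close>, and regularity makes these edges finite in number, so the product is countably
    infinite.\<close>
  have "\<exists>\<epsilon>. bij_betw \<epsilon> (?E v \<times> (UNIV :: nat set)) (UNIV :: nat set)" if "regular_vertex G v" "v \<notin> H" for v
  proof -
    have "finite (?E v)"
      by (rule finite_subset[of _ "out_arcs G v"]) (use that(1) in \<open>auto simp: regular_vertex_def\<close>)
    moreover have "\<not> head G ` out_arcs G v \<subseteq> H"
      using that sat unfolding saturated_def by blast
    then have "?E v \<noteq> {}" by blast
    ultimately have "countable (?E v \<times> (UNIV :: nat set))" "infinite (?E v \<times> (UNIV :: nat set))"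
      by (auto simp: countable_finite finite_cartesian_product_iff)
    then show ?thesis by (metis countableE_infinite)
  qed
  then obtain \<epsilon> where \<epsilon>: "\<And>v. regular_vertex G v \<Longrightarrow> v \<notin> H \<Longrightarrow>
      bij_betw (\<epsilon> v) (?E v \<times> (UNIV :: nat set)) (UNIV :: nat set)" by metis
  define \<beta> where "\<beta> v = inv_into (?E v \<times> UNIV) (\<epsilon> v)" for v
  have \<beta>\<epsilon>: "\<beta> v (\<epsilon> v (e, n)) = (e, n)" if "regular_vertex G v" "v \<notin> H" "e \<in> ?E v" for v e n
    unfolding \<beta>_def using bij_betw_inv_into_left[OF \<epsilon>[OF that(1,2)], of "(e, n)"] that(3) by simp
  have \<epsilon>\<beta>: "\<epsilon> v (\<beta> v n) = n" if "regular_vertex G v" "v \<notin> H" for v n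
    unfolding \<beta>_def using bij_betw_inv_into_right[OF \<epsilon>[OF that], of n] by simp
  have \<beta>E: "fst (\<beta> v n) \<in> ?E v" if "regular_vertex G v" "v \<notin> H" for v n
  proof -
    have "\<beta> v n \<in> ?E v \<times> UNIV"
      unfolding \<beta>_def using bij_betw_imp_surj_on[OF \<epsilon>[OF that]] by (intro inv_into_into) simp
    then show ?thesis by (auto simp: mem_Times_iff)
  qed
  have reg: "regular_vertex G (tail G e)" if "e \<in> arcs G" for e
    using that rf unfolding regular_vertex_def row_finite_def by (auto simp: out_arcs_def)
  have tail: "tail G e \<notin> H" if "e \<in> arcs G" "head G e \<notin> H" for e
    using her arc_implies_awalk[OF that(1)] that(2) unfolding hereditary_def vertex_ge_def by blast
  let ?act = "branching_act G H \<beta> \<epsilon> :: _ \<Rightarrow> ('a \<times> nat \<Rightarrow> 'c) \<Rightarrow> _"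
  have m2: "rep ?act (gen a * gen b - q) f x = ?act a (?act b f) x - rep ?act q f x" for a b f x q
    by (simp add: rep_minus single_mult_single)
  let ?N = "{p \<in> carrier (free_lpa K G). \<forall>f x. rep ?act p f x = 0}"
  have vanish: "rep ?act p f (y, n) = 0" if p: "p \<in> lpa_relators K G" for p f y n
  proof -
    \<comment> \<open>Decoding \<open>\<epsilon> (tail G e) (e, n)\<close> with
      \<open>\<beta>\<close> returns \<open>e\<close>, and \<open>Edge e'\<close> gives a nonzero
      value only if this is \<open>e'\<close>.\<close>
    have r3: "?act (Ghost e) (?act (Edge e') f) (y, n) = (if e = e' then ?act (Vertex (head G e)) f (y, n) else 0)"
      if e: "e \<in> arcs G" "e' \<in> arcs G" for e e'
    proof (cases "y = head G e \<and> y \<notin> H")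
      case True
      then have b: "\<beta> (tail G e) (\<epsilon> (tail G e) (e, n)) = (e, n)"
        using \<beta>\<epsilon>[OF reg[OF e(1)] tail[OF e(1)], of e n] e(1) by auto
      have t: "tail G e \<notin> H" "head G e \<notin> H" "y = head G e" using True tail[OF e(1)] by auto
      show ?thesis by (cases "e = e'") (use t b in simp_all)
    next
      case False
      then show ?thesis by (simp only: branching_act.simps) auto
    qed
    \<comment> \<open>Only the edge encoded in \<open>n\<close> contributes to the sum, and
      re-encoding with \<open>\<epsilon>\<close> returns \<open>n\<close>.\<close>
    have r4: "?act (Vertex v) f (y, n) = (\<Sum>e\<in>out_arcs G v. ?act (Edge e) (?act (Ghost e) f) (y, n))"
      if v: "regular_vertex G v" for v
    proof (cases "y = v \<and> v \<notin> H")
      case True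
      let ?e = "fst (\<beta> v n)"
      have b: "?e \<in> out_arcs G v" "head G ?e \<notin> H" "\<epsilon> v (\<beta> v n) = n"
        using \<beta>E[OF v] \<epsilon>\<beta>[OF v] True by auto
      have "(\<Sum>e\<in>out_arcs G v. ?act (Edge e) (?act (Ghost e) f) (y, n)) =
        (\<Sum>e\<in>out_arcs G v. if e = ?e then f (y, n) else 0)"
        by (rule sum.cong) (use True b in auto)
      then show ?thesis using b(1) v True by (simp add: regular_vertex_def)
    next
      case False
      then have "(\<Sum>e\<in>out_arcs G v. ?act (Edge e) (?act (Ghost e) f) (y, n)) = 0"
        by (intro sum.neutral ballI) auto
      then show ?thesis using False by auto
    qed
    have r2: "?act (Ghost e) (?act (Vertex (tail G e)) f) (y, n) = ?act (Ghost e) f (y, n)" if "e \<in> arcs G" for e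
      using tail[OF that] by auto
    have
      "rep ?act (gen (Vertex v) * gen (Vertex w) - (if v = w then gen (Vertex v) else 0)) f (y, n) = 0"
      "rep ?act (gen (Vertex (tail G e)) * gen (Edge e) - gen (Edge e)) f (y, n) = 0"
      "rep ?act (gen (Edge e) * gen (Vertex (head G e)) - gen (Edge e)) f (y, n) = 0"
      "rep ?act (gen (Vertex (head G e)) * gen (Ghost e) - gen (Ghost e)) f (y, n) = 0"
      for v w e by (auto simp: m2)
    moreover have "rep ?act (gen (Ghost e) * gen (Vertex (tail G e)) - gen (Ghost e)) f (y, n) = 0"
      if "e \<in> arcs G" for e
      unfolding m2 r2[OF that] by simp
    moreover have "rep ?act (gen (Ghost e) * gen (Edge e') - (if e = e' then gen (Vertex (head G e)) else 0)) f (y, n) = 0"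
      if "e \<in> arcs G" "e' \<in> arcs G" for e e'
      unfolding m2 r3[OF that] by simp
    moreover have "rep ?act (gen (Vertex v) - (\<Sum>e\<in>out_arcs G v. gen (Edge e) * gen (Ghost e))) f (y, n) = 0"
      if "regular_vertex G v" for v
      using r4[OF that] by (simp add: rep_minus rep_sum single_mult_single)
    ultimately show ?thesis
      using p unfolding lpa_relators_def Un_iff by (elim disjE CollectE exE conjE) (simp_all only:)
  qed
  have "hs_ideal K G H \<subseteq> ?N"
    unfolding hs_ideal_def
  proof (rule hull_minimal)
    show "two_sided_ideal (free_lpa K G) ?N" by (rule rep_kernel_ideal[OF linear_branching_act])
    have "rep ?act (mon [Vertex v]) f x = 0" if "v \<in> H" for v f x
      using that by (cases x) simp
    then show "lpa_relators K G \<union> (\<lambda>v. mon [Vertex v]) ` H \<subseteq> ?N"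
      using vanish lpa_relators_carrier[of K] HV by (auto intro!: carrier_free_lpa_mon)
  qed
  moreover have "mon [Vertex v] \<notin> ?N" if "v \<notin> H" for v
  proof
    assume "mon [Vertex v] \<in> ?N"
    then have "rep ?act (mon [Vertex v]) (\<lambda>_. 1) (v, 0) = 0" by blast
    then show False using that by simp
  qed
  ultimately show "vertices_in G (hs_ideal K G H) \<subseteq> H" unfolding vertices_in_def by blast
qed

end

section \<open>The grading\<close>

abbreviation word_degree :: "('a, 'b) lpa_gen list \<Rightarrow> int" where
  "word_degree w \<equiv> (\<Sum>g\<leftarrow>w. gen_degree g)"

definition hom_component :: "('k::field, 'a, 'b) free_elem \<Rightarrow> int \<Rightarrow> ('k, 'a, 'b) free_elem" where
  "hom_component p n = (\<Sum>w\<in>Poly_Mapping.keys p.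
     if word_degree w = n then Poly_Mapping.single w (Poly_Mapping.lookup p w) else 0)"

lemma lookup_hom_component: "Poly_Mapping.lookup (hom_component p n) w = (if word_degree w = n then Poly_Mapping.lookup p w else 0)"
proof -
  have "Poly_Mapping.lookup (hom_component p n) w = (\<Sum>u\<in>Poly_Mapping.keys p.
      if u = w then (if word_degree w = n then Poly_Mapping.lookup p w else 0) else 0)"
    unfolding hom_component_def lookup_sum by (rule sum.cong) (auto simp: lookup_single when_def)
  then show ?thesis by (simp add: in_keys_iff)
qed

lemma hom_component_add: "hom_component (p + q) n = hom_component p n + hom_component q n"
  by (rule poly_mapping_eqI) (simp add: lookup_hom_component lookup_add)

lemma hom_component_minus: "hom_component (p - q) n = hom_component p n - hom_component q n"
  by (rule poly_mapping_eqI) (simp add: lookup_hom_component lookup_minus)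

lemma hom_component_0 [simp]: "hom_component 0 n = 0"
  by (simp add: hom_component_def)

lemma hom_component_sum: "hom_component (sum f A) n = (\<Sum>x\<in>A. hom_component (f x) n)"
  by (induct A rule: infinite_finite_induct) (simp_all add: hom_component_add)

lemma hom_component_single: "hom_component (Poly_Mapping.single w c) n = (if word_degree w = n then Poly_Mapping.single w c else 0)"
  by (rule poly_mapping_eqI) (auto simp: lookup_hom_component lookup_single when_def)

lemma keys_hom_component: "Poly_Mapping.keys (hom_component p n) = {w \<in> Poly_Mapping.keys p. word_degree w = n}"
  by (auto simp: in_keys_iff lookup_hom_component split: if_splits)

lemma hom_component_carrier: "p \<in> carrier (free_lpa K G) \<Longrightarrow> hom_component p n \<in> carrier (free_lpa K G)"
  by (simp add: carrier_free_lpa keys_hom_component)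

lemma hom_component_single_mult: "hom_component (Poly_Mapping.single w c * p) n = Poly_Mapping.single w c * hom_component p (n - word_degree w)"
proof -
  have "hom_component (Poly_Mapping.single w c * p) n = (\<Sum>u\<in>Poly_Mapping.keys p.
      hom_component (Poly_Mapping.single (w @ u) (c * Poly_Mapping.lookup p u)) n)"
    by (subst sum_monomials[of p]) (simp add: sum_distrib_left single_mult_single hom_component_sum)
  also have "\<dots> = (\<Sum>u\<in>Poly_Mapping.keys p. Poly_Mapping.single w c *
      (if word_degree u = n - word_degree w then Poly_Mapping.single u (Poly_Mapping.lookup p u) else 0))"
    by (rule sum.cong) (auto simp: hom_component_single single_mult_single)
  finally show ?thesis by (simp add: hom_component_def sum_distrib_left)
qed

lemma hom_component_mult_single: "hom_component (p * Poly_Mapping.single w c) n = hom_component p (n - word_degree w) * Poly_Mapping.single w c"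
proof -
  have "hom_component (p * Poly_Mapping.single w c) n = (\<Sum>u\<in>Poly_Mapping.keys p.
      hom_component (Poly_Mapping.single (u @ w) (Poly_Mapping.lookup p u * c)) n)"
    by (subst sum_monomials[of p]) (simp add: sum_distrib_right single_mult_single hom_component_sum)
  also have "\<dots> = (\<Sum>u\<in>Poly_Mapping.keys p.
      (if word_degree u = n - word_degree w then Poly_Mapping.single u (Poly_Mapping.lookup p u) else 0) *
      Poly_Mapping.single w c)"
    by (rule sum.cong) (auto simp: hom_component_single single_mult_single)
  finally show ?thesis by (simp add: hom_component_def sum_distrib_right)
qed

lemma sum_hom_component: "p = (\<Sum>n\<in>word_degree ` Poly_Mapping.keys p. hom_component p n)"
  by (rule poly_mapping_eqI) (auto simp: lookup_sum lookup_hom_component in_keys_iff)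

text \<open>Each relator is homogeneous: it is its own component in one degree and has component
  zero in all others.\<close>

lemma hom_component_relator:
  assumes "r \<in> lpa_relators K G"
  shows "hom_component r n \<in> {r, 0}"
  using assms unfolding lpa_relators_def Un_iff
  by (elim disjE CollectE exE conjE) (auto simp: single_mult_single hom_component_minus hom_component_single hom_component_sum)

text \<open>The elements all of whose components stay in the ideal form an ideal themselves, and it
  contains the generators because those are homogeneous.\<close>

lemma (in wf_digraph) hom_component_hs_ideal:
  assumes "H \<subseteq> verts G" "p \<in> hs_ideal K G H"
  shows "hom_component p n \<in> hs_ideal K G H"
proof -
  let ?J = "hs_ideal K G H"
  have id: "two_sided_ideal (free_lpa K G) ?J"
    using hs_ideal_preideal[OF assms(1)] by (rule lpa_preideal.ideal)
  note J = free_idealD[OF id]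
  have "two_sided_ideal (free_lpa K G) hull (lpa_relators K G \<union> (\<lambda>v. mon [Vertex v]) ` H) \<subseteq>
    {p \<in> ?J. \<forall>n. hom_component p n \<in> ?J}"
  proof (rule hull_minimal)
    show "two_sided_ideal (free_lpa K G) {p \<in> ?J. \<forall>n. hom_component p n \<in> ?J}"
      by (rule free_idealI)
        (use J(1) in \<open>auto simp: hom_component_add hom_component_single_mult hom_component_mult_single intro: J(2-4,9,10)\<close>)
    have "r \<in> ?J" "hom_component r n \<in> ?J" if "r \<in> lpa_relators K G" for r n
    proof -
      show "r \<in> ?J" using that unfolding hs_ideal_def by (blast intro: hull_inc)
      then show "hom_component r n \<in> ?J" using hom_component_relator[OF that, of n] J(2) by auto
    qed
    moreover have "mon [Vertex v] \<in> ?J" "hom_component (mon [Vertex v]) n \<in> ?J" if "v \<in> H" for v n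
    proof -
      show "mon [Vertex v] \<in> ?J" using that unfolding hs_ideal_def by (blast intro: hull_inc)
      then show "hom_component (mon [Vertex v]) n \<in> ?J" using J(2) by (simp add: hom_component_single)
    qed
    ultimately show "lpa_relators K G \<union> (\<lambda>v. mon [Vertex v]) ` H \<subseteq> {p \<in> ?J. \<forall>n. hom_component p n \<in> ?J}"
      by blast
  qed
  then show ?thesis using assms(2) unfolding hs_ideal_def[symmetric] by blast
qed

section \<open>Ideals of the quotient algebra\<close>

context lpa_preideal
begin

abbreviation quot :: "('k, ('k, 'a, 'b) free_elem set) module" where
  "quot \<equiv> quotient_algebra (free_lpa K G) J"

abbreviation coset :: "('k, 'a, 'b) free_elem \<Rightarrow> ('k, 'a, 'b) free_elem set" where
  "coset p \<equiv> J +>\<^bsub>free_lpa K G\<^esub> p"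

lemma coset_mem: "x \<in> coset p \<longleftrightarrow> x - p \<in> J"
  by (auto simp: a_r_coset_def' algebra_simps intro: bexI[of _ "x - p"])

lemma coset_self: "p \<in> coset p"
  by (simp add: coset_mem J_zero)

lemma coset_eq_iff: "coset p = coset q \<longleftrightarrow> p - q \<in> J"
proof
  assume "coset p = coset q"
  then show "p - q \<in> J" using coset_self[of p] coset_mem[of p q] by simp
next
  assume pq: "p - q \<in> J"
  have "x - p \<in> J \<longleftrightarrow> x - q \<in> J" for x
    using J_mem_cong[of "x - q" "x - p"] pq by (simp add: algebra_simps)
  then show "coset p = coset q" by (auto simp: coset_mem)
qed

lemma coset_eq_J: "coset p = J \<longleftrightarrow> p \<in> J"
proof -
  have "coset 0 = J" by (auto simp: coset_mem)
  then show ?thesis using coset_eq_iff[of p 0] by simp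
qed

lemma coset_carrier: "x \<in> coset p \<Longrightarrow> p \<in> carrier (free_lpa K G) \<Longrightarrow> x \<in> carrier (free_lpa K G)"
  using carrier_free_lpa_add[of "x - p" K G p] J_sub by (auto simp: coset_mem)

lemma quot_simps [simp]:
  "carrier quot = coset ` carrier (free_lpa K G)"
  "ring.zero quot = J"
  by (auto simp: quotient_algebra_def A_RCOSETS_def')

lemma quot_add [simp]: "coset p \<oplus>\<^bsub>quot\<^esub> coset q = coset (p + q)"
proof -
  have "coset p \<oplus>\<^bsub>quot\<^esub> coset q = {x + y | x y. x \<in> coset p \<and> y \<in> coset q}"
    by (auto simp: quotient_algebra_def set_add_def')
  also have "\<dots> = coset (p + q)"
  proof (intro equalityI subsetI)
    fix z assume "z \<in> coset (p + q)"
    then have "z - q \<in> coset p" by (simp add: coset_mem algebra_simps)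
    then show "z \<in> {x + y | x y. x \<in> coset p \<and> y \<in> coset q}"
      using coset_self[of q] by (metis (mono_tags, lifting) diff_add_cancel mem_Collect_eq)
  next
    fix z assume "z \<in> {x + y | x y. x \<in> coset p \<and> y \<in> coset q}"
    then obtain x y where "z = x + y" "x - p \<in> J" "y - q \<in> J" by (auto simp: coset_mem)
    then show "z \<in> coset (p + q)" using J_add[of "x - p" "y - q"] by (simp add: coset_mem algebra_simps)
  qed
  finally show ?thesis .
qed

lemma quot_mult [simp]:
  assumes p: "p \<in> carrier (free_lpa K G)" and q: "q \<in> carrier (free_lpa K G)"
  shows "coset p \<otimes>\<^bsub>quot\<^esub> coset q = coset (p * q)"
proof -
  have 1: "coset (x * y) = coset (p * q)" if x: "x \<in> coset p" and y: "y \<in> coset q" for x y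
  proof -
    have "(x - p) * y \<in> J" using J_mult_right x coset_carrier[OF y q] by (simp add: coset_mem)
    moreover have "p * (y - q) \<in> J" using J_mult_left p y by (simp add: coset_mem)
    ultimately have "(x - p) * y + p * (y - q) \<in> J" by (rule J_add)
    then show ?thesis by (simp add: coset_eq_iff algebra_simps)
  qed
  have "coset p \<otimes>\<^bsub>quot\<^esub> coset q = (\<Union>x\<in>coset p. \<Union>y\<in>coset q. coset (x * y))"
    by (simp add: quotient_algebra_def rcoset_mult_def)
  also have "\<dots> = coset (p * q)" using 1 coset_self by blast
  finally show ?thesis .
qed

lemma quot_smult [simp]: "c \<odot>\<^bsub>quot\<^esub> coset p = coset (scal c * p)"
proof -
  have 1: "coset (scal c * x) = coset (scal c * p)" if "x \<in> coset p" for x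
    using J_scal[of "x - p" c] that by (simp add: coset_mem coset_eq_iff right_diff_distrib)
  have "c \<odot>\<^bsub>quot\<^esub> coset p = (\<Union>x\<in>coset p. coset (scal c * x))"
    by (simp add: quotient_algebra_def)
  also have "\<dots> = coset (scal c * p)" using 1 coset_self by blast
  finally show ?thesis .
qed

lemma abelian_group_quot: "abelian_group quot"
proof (rule abelian_groupI)
  fix x assume "x \<in> carrier quot"
  then obtain p where p: "p \<in> carrier (free_lpa K G)" "x = coset p" by auto
  have "coset (- p) \<oplus>\<^bsub>quot\<^esub> x = \<zero>\<^bsub>quot\<^esub>" using p J_zero coset_eq_J[of 0] by simp
  then show "\<exists>y\<in>carrier quot. y \<oplus>\<^bsub>quot\<^esub> x = \<zero>\<^bsub>quot\<^esub>"
    using p carrier_free_lpa_uminus[of p K G] by (intro bexI[of _ "coset (- p)"]) auto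
  have "coset 0 \<oplus>\<^bsub>quot\<^esub> x = x" using p by simp
  then show "\<zero>\<^bsub>quot\<^esub> \<oplus>\<^bsub>quot\<^esub> x = x" using coset_eq_J[of 0] J_zero by simp
next
  show "\<zero>\<^bsub>quot\<^esub> \<in> carrier quot"
    using coset_eq_J[of 0] J_zero zero_carrier_free_lpa by (metis imageI quot_simps)
qed (auto simp: carrier_free_lpa_add algebra_simps)

lemma finsum_quot:
  assumes "finite A" "\<And>i. i \<in> A \<Longrightarrow> f i \<in> carrier (free_lpa K G)"
  shows "(\<Oplus>\<^bsub>quot\<^esub>i\<in>A. coset (f i)) = coset (sum f A)"
proof -
  interpret Q: abelian_group quot by (rule abelian_group_quot)
  show ?thesis using assms
  proof (induct A rule: finite_induct)
    case empty
    then show ?case using coset_eq_J[of 0] J_zero by simp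
  next
    case (insert i A)
    then show ?case by (subst Q.finsum_insert) auto
  qed
qed

lemma ideal_quot_of_free:
  assumes I: "two_sided_ideal (free_lpa K G) I"
  shows "two_sided_ideal quot (coset ` I)"
proof -
  interpret Q: abelian_group quot by (rule abelian_group_quot)
  note I' = free_idealD[OF I]
  have neg: "inv\<^bsub>add_monoid quot\<^esub> coset p = coset (- p)" if "p \<in> carrier (free_lpa K G)" for p
  proof -
    have "\<ominus>\<^bsub>quot\<^esub> coset p = coset (- p)"
      by (rule Q.minus_equality)
        (use that carrier_free_lpa_uminus J_zero coset_eq_J[of 0] in auto)
    then show ?thesis by (simp add: a_inv_def)
  qed
  have "subgroup (coset ` I) (add_monoid quot)"
  proof
    show "coset ` I \<subseteq> carrier (add_monoid quot)" using I'(1) by auto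
    show "\<one>\<^bsub>add_monoid quot\<^esub> \<in> coset ` I"
      using coset_eq_J[of 0] J_zero imageI[OF I'(2), of coset] by simp
    show "inv\<^bsub>add_monoid quot\<^esub> x \<in> coset ` I" if x: "x \<in> coset ` I" for x
    proof -
      obtain p where p: "p \<in> I" "x = coset p" using x by blast
      then show ?thesis using neg[of p] I'(1) I'(5)[OF p(1)] by auto
    qed
  qed (auto intro: I'(3))
  then show ?thesis
    unfolding two_sided_ideal_def
  proof (intro conjI allI ballI)
    fix x assume "x \<in> coset ` I"
    then obtain p where p: "p \<in> I" "x = coset p" by blast
    show "c \<odot>\<^bsub>quot\<^esub> x \<in> coset ` I" for c
      using I'(4)[OF p(1)] p(2) by simp
    fix a assume "a \<in> carrier quot"
    then obtain q where q: "q \<in> carrier (free_lpa K G)" "a = coset q" by auto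
    have "p \<in> carrier (free_lpa K G)" using p(1) I'(1) by blast
    then show "a \<otimes>\<^bsub>quot\<^esub> x \<in> coset ` I" "x \<otimes>\<^bsub>quot\<^esub> a \<in> coset ` I"
      using I'(7,8)[OF p(1) q(1)] p(2) q by simp_all
  qed (rule additive_subgroup.intro)
qed

text \<open>Ideals above \<open>J\<close> are determined by their images, so equal images in the
  quotient imply equal ideals of the free algebra.\<close>

lemma coset_mem_image:
  assumes "two_sided_ideal (free_lpa K G) I" "J \<subseteq> I"
  shows "coset p \<in> coset ` I \<longleftrightarrow> p \<in> I"
proof
  assume "coset p \<in> coset ` I"
  then obtain q where q: "q \<in> I" "p - q \<in> J" by (auto simp: coset_eq_iff)
  then have "p - q + q \<in> I" using free_idealD(3)[OF assms(1)] assms(2) by blast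
  then show "p \<in> I" by simp
qed simp

text \<open>Half of the correspondence of ideals: a chain in the quotient is pulled back to ideals
  that contain the relators, and the image recovers the original chain.\<close>

lemma
  assumes I: "two_sided_ideal quot I"
  shows preideal_of_quot: "lpa_preideal G K {p \<in> carrier (free_lpa K G). coset p \<in> I}"
    and image_of_quot: "I = coset ` {p \<in> carrier (free_lpa K G). coset p \<in> I}"
proof -
  let ?I = "{p \<in> carrier (free_lpa K G). coset p \<in> I}"
  interpret I: additive_subgroup I quot using I by (simp add: two_sided_ideal_def)
  have sm: "coset (scal c * p) \<in> I" if "coset p \<in> I" for c p
    using I that unfolding two_sided_ideal_def by (metis quot_smult)
  have mult: "coset (p * q) \<in> I" "coset (q * p) \<in> I"
    if "coset p \<in> I" "p \<in> carrier (free_lpa K G)" "q \<in> carrier (free_lpa K G)" for p q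
  proof -
    have "coset q \<in> carrier quot" using that by simp
    then have "coset q \<otimes>\<^bsub>quot\<^esub> coset p \<in> I" "coset p \<otimes>\<^bsub>quot\<^esub> coset q \<in> I"
      using I that(1) unfolding two_sided_ideal_def by blast+
    then show "coset (p * q) \<in> I" "coset (q * p) \<in> I" using that by simp_all
  qed
  have zero: "J \<in> I" using I.zero_closed by simp
  have add: "coset (p + q) \<in> I" if "coset p \<in> I" "coset q \<in> I" for p q
    using I.a_closed[OF that] by simp
  have sc: "scal c * p \<in> carrier (free_lpa K G)" if "p \<in> carrier (free_lpa K G)" for c p
    using that keys_scal_mult[of c p] by (auto simp: carrier_free_lpa)
  show "lpa_preideal G K ?I"
  proof
    show "two_sided_ideal (free_lpa K G) ?I"
    proof (rule free_idealI)
      show "0 \<in> ?I" using zero coset_eq_J[of 0] J_zero by (simp add: zero_carrier_free_lpa)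
    qed (auto simp: carrier_free_lpa_add carrier_free_lpa_mult carrier_free_lpa_mon add sm mult sc)
    have "coset r = J" if "r \<in> lpa_relators K G" for r
      using relators that by (auto simp: coset_eq_J)
    then show "lpa_relators K G \<subseteq> ?I"
      using lpa_relators_carrier zero by auto
  qed
  show "I = coset ` ?I" using I.a_subset by auto
qed

end

lemma (in wf_digraph) lpa_ideal_preideal: "lpa_preideal G K (lpa_ideal K G)"
proof
  show "two_sided_ideal (free_lpa K G) (lpa_ideal K G)"
    unfolding lpa_ideal_def by (rule free_ideal_hull[OF lpa_relators_carrier])
  show "lpa_relators K G \<subseteq> lpa_ideal K G"
    unfolding lpa_ideal_def by (rule hull_subset)
qed

lemma (in lpa_preideal) lpa_ideal_subset: "lpa_ideal K G \<subseteq> J"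
  unfolding lpa_ideal_def by (rule hull_minimal, rule relators, rule ideal)

lemma satisfies_acc_subset:
  assumes "satisfies_acc \<F>" "\<A> \<subseteq> \<F>"
  shows "satisfies_acc \<A>"
  unfolding satisfies_acc_def
proof (intro allI impI)
  fix C :: "nat \<Rightarrow> 'a set"
  assume "\<forall>n. C n \<in> \<A> \<and> C n \<subseteq> C (Suc n)"
  then have "\<forall>n. C n \<in> \<F> \<and> C n \<subseteq> C (Suc n)" using assms(2) by blast
  then show "\<exists>N. \<forall>n\<ge>N. C n = C N"
    by (rule assms(1)[unfolded satisfies_acc_def, THEN spec, THEN mp])
qed

theorem theorem14:
  fixes K :: "'k::field itself" and G :: "('a, 'b) pre_digraph"
  assumes "wf_digraph G" and "row_finite G"
  shows "(satisfies_acc {I. two_sided_ideal (lpa K G) I} \<longleftrightarrow>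
            satisfies_acc {I. graded_ideal (lpa K G) (lpa_component K G) I}) \<and>
         (satisfies_acc {I. graded_ideal (lpa K G) (lpa_component K G) I} \<longleftrightarrow>
            satisfies_acc {hs_closure G X | X. X \<subseteq> verts G})"
proof -
  interpret wf_digraph G by (rule assms(1))
  interpret L: lpa_preideal G K "lpa_ideal K G" by (rule lpa_ideal_preideal)
  let ?ideals = "satisfies_acc {I. two_sided_ideal (lpa K G) I}"
  let ?graded = "satisfies_acc {I. graded_ideal (lpa K G) (lpa_component K G) I}"
  let ?closures = "satisfies_acc {hs_closure G X | X. X \<subseteq> verts G}"
  have lpa: "lpa K G = L.quot" by (simp add: lpa_def)
  have "?graded" if ?ideals
    using that by (rule satisfies_acc_subset) (auto simp: graded_ideal_def)
  moreover have "?closures" if graded: ?graded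
    unfolding satisfies_acc_def
  proof (intro allI impI)
    fix C :: "nat \<Rightarrow> 'a set"
    assume C: "\<forall>n. C n \<in> {hs_closure G X | X. X \<subseteq> verts G} \<and> C n \<subseteq> C (Suc n)"
    have "C n \<in> {H. hereditary G H \<and> saturated G H}" for n
      unfolding hs_closures[symmetric] using C by simp
    then have hs: "hereditary G (C n)" "saturated G (C n)" for n by simp_all
    then have V: "C n \<subseteq> verts G" for n by (simp add: hereditary_def)
    let ?J = "\<lambda>n. hs_ideal K G (C n)"
    have pre: "lpa_preideal G K (?J n)" for n by (rule hs_ideal_preideal[OF V])
    note id = lpa_preideal.ideal[OF pre] and sub = lpa_preideal.lpa_ideal_subset[OF pre]
    let ?I = "\<lambda>n. L.coset ` ?J n"
    \<comment> \<open>The homogeneous components of a representative stay in the ideal of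
      \<open>C n\<close>, so their cosets give the required decomposition.\<close>
    have "graded_ideal (lpa K G) (lpa_component K G) (?I n)" for n
      unfolding graded_ideal_def
    proof (intro conjI ballI)
      show "two_sided_ideal (lpa K G) (?I n)" unfolding lpa by (rule L.ideal_quot_of_free[OF id])
      fix x assume "x \<in> ?I n"
      then obtain p where p: "p \<in> ?J n" "x = L.coset p" by blast
      let ?N = "word_degree ` Poly_Mapping.keys p"
      have c: "p \<in> carrier (free_lpa K G)" using free_idealD(1)[OF id] p(1) by blast
      have "L.coset (hom_component p m) \<in> ?I n \<inter> lpa_component K G m" for m
        unfolding lpa_component_def using hom_component_hs_ideal[OF V p(1)] hom_component_carrier[OF c]
        by (auto simp: keys_hom_component)
      moreover have "x = (\<Oplus>\<^bsub>lpa K G\<^esub>m\<in>?N. L.coset (hom_component p m))"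
      proof -
        have "(\<Oplus>\<^bsub>lpa K G\<^esub>m\<in>?N. L.coset (hom_component p m)) = L.coset (\<Sum>m\<in>?N. hom_component p m)"
          unfolding lpa by (rule L.finsum_quot) (simp_all add: hom_component_carrier[OF c])
        then show ?thesis by (simp only: p(2) flip: sum_hom_component)
      qed
      ultimately show "\<exists>N f. finite N \<and> (\<forall>m\<in>N. f m \<in> ?I n \<inter> lpa_component K G m) \<and>
          x = (\<Oplus>\<^bsub>lpa K G\<^esub>m\<in>N. f m)"
        by (intro exI[of _ ?N] exI[of _ "\<lambda>m. L.coset (hom_component p m)"]) auto
    qed
    moreover have "?I n \<subseteq> ?I (Suc n)" for n
      using C by (intro image_mono hs_ideal_mono) blast
    ultimately have "\<forall>n. ?I n \<in> {I. graded_ideal (lpa K G) (lpa_component K G) I} \<and> ?I n \<subseteq> ?I (Suc n)"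
      by (intro allI conjI CollectI)
    then have "\<exists>N. \<forall>n\<ge>N. ?I n = ?I N"
      by (rule graded[unfolded satisfies_acc_def, THEN spec, THEN mp])
    then obtain N where N: "\<And>n. n \<ge> N \<Longrightarrow> ?I n = ?I N" by blast
    \<comment> \<open>Equality of the ideals passes back to the sets, which are the vertices
      contained in them.\<close>
    have "C n = C N" if "n \<ge> N" for n
    proof -
      have "p \<in> ?J n \<longleftrightarrow> p \<in> ?J N" for p
        using L.coset_mem_image[OF id sub, of p n] L.coset_mem_image[OF id sub, of p N]
        unfolding N[OF that] by (rule trans[OF sym])
      then have J: "?J n = ?J N" by blast
      have "C n = vertices_in G (?J n)" by (rule vertices_in_hs_ideal[OF assms(2) hs, symmetric])
      also have "\<dots> = vertices_in G (?J N)" by (rule arg_cong[OF J])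
      also have "\<dots> = C N" by (rule vertices_in_hs_ideal[OF assms(2) hs])
      finally show ?thesis .
    qed
    then show "\<exists>N. \<forall>n\<ge>N. C n = C N" by (intro exI allI impI)
  qed
  moreover have "?ideals" if closures: ?closures
    unfolding satisfies_acc_def
  proof (intro allI impI)
    fix I :: "nat \<Rightarrow> ('k, 'a, 'b) free_elem set set"
    assume I: "\<forall>n. I n \<in> {I. two_sided_ideal (lpa K G) I} \<and> I n \<subseteq> I (Suc n)"
    let ?J = "\<lambda>n. {p \<in> carrier (free_lpa K G). L.coset p \<in> I n}"
    have id: "two_sided_ideal L.quot (I n)" for n using I lpa by simp
    have "\<exists>N. \<forall>n\<ge>N. ?J n = ?J N"
      by (rule ideal_chain_stabilizes[OF assms(2) closures L.preideal_of_quot[OF id]]) (use I in blast)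
    then obtain N where N: "\<And>n. n \<ge> N \<Longrightarrow> ?J n = ?J N" by blast
    have "I n = I N" if "n \<ge> N" for n
    proof -
      have "I n = L.coset ` ?J n" by (rule L.image_of_quot[OF id])
      also have "?J n = ?J N" by (rule N[OF that])
      also have "L.coset ` ?J N = I N" by (rule L.image_of_quot[OF id, symmetric])
      finally show ?thesis .
    qed
    then show "\<exists>N. \<forall>n\<ge>N. I n = I N" by blast
  qed
  ultimately show ?thesis by blast
qed

end
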